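(* Let $N$ be a central subgroup of a finitely generated group $G$, endowed with the metric induced from $G$. Suppose that for some non-principal ultrafilter $\omega$ and some scaling sequence $d=(d_n)$, $\mathrm{Con}^\omega(G/N,d)$ is an $\mathbb R$-tree. Then $\mathrm{Con}^\omega(G,d)$ is bi-Lipschitz equivalent to $\mathrm{Con}^\omega(N,d)\times \mathrm{Con}^\omega(G/N,d)$ endowed with the product metric.
   Context: A scaling sequence is an unbounded non-decreasing sequence $d=(d_n)_{n\in\mathbb N}$ of positive real numbers. For a metric space $(X,\mathrm{dist})$ with base point $x_0$ and a non-principal ultrafilter $\omega$ on $\mathbb N$, $\mathrm{Con}^\omega(X,d)$ is the set of sequences $(x_n)$ in $X$ with $\mathrm{dist}(x_0,x_n)/d_n$ bounded, modulo $\lim^\omega \mathrm{dist}(x_n,y_n)/d_n=0$, with metric $\lim^\omega \mathrm{dist}(x_n,y_n)/d_n$. The group $G$ carries the word metric of a finite generating set $S$, the quotient $G/N$ carries the word metric of the image of $S$, and $N$ carries the restriction of the metric of $G$; base points are the identity elements. The product metric on $X\times Y$ is $\mathrm{dist}((x_1,y_1),(x_2,y_2))=\mathrm{dist}_X(x_1,x_2)+\mathrm{dist}_Y(y_1,y_2)$. *)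

theory Defs
  imports "HOL-Analysis.Analysis" "HOL-Algebra.Coset" "HOL-Algebra.Generated_Groups"
begin

subsection \<open>Ultrafilters and scaling sequences\<close>

definition ultrafilter :: "'a filter \<Rightarrow> bool" where
  "ultrafilter \<omega> \<longleftrightarrow>
     \<omega> \<noteq> bot \<and> (\<forall>P. eventually P \<omega> \<or> eventually (\<lambda>x. \<not> P x) \<omega>)"

definition nonprincipal_ultrafilter :: "'a filter \<Rightarrow> bool" where
  "nonprincipal_ultrafilter \<omega> \<longleftrightarrow> ultrafilter \<omega> \<and> (\<forall>a. \<omega> \<noteq> principal {a})"

definition scaling_sequence :: "(nat \<Rightarrow> real) \<Rightarrow> bool" where
  "scaling_sequence d \<longleftrightarrow> (\<forall>n. 0 < d n) \<and> incseq d \<and> \<not> bdd_above (range d)"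

subsection \<open>Word metrics\<close>

definition word_length :: "('a, 'b) monoid_scheme \<Rightarrow> 'a set \<Rightarrow> 'a \<Rightarrow> nat" where
  "word_length G S g =
     (LEAST n. \<exists>ws. set ws \<subseteq> S \<union> m_inv G ` S \<and> length ws = n \<and> foldr (\<otimes>\<^bsub>G\<^esub>) ws \<one>\<^bsub>G\<^esub> = g)"

text \<open>The values outside the carrier are set to 0 because \<^locale>\<open>Metric_space\<close> demands
  symmetry and nonnegativity of the distance on the whole type. The same applies to
  \<open>cone_dist\<close> below.\<close>

definition word_metric :: "('a, 'b) monoid_scheme \<Rightarrow> 'a set \<Rightarrow> 'a metric" where
  "word_metric G S =
     metric (carrier G,
       \<lambda>g h. if g \<in> carrier G \<and> h \<in> carrier G
             then real (word_length G S (inv\<^bsub>G\<^esub> g \<otimes>\<^bsub>G\<^esub> h)) else 0)"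

subsection \<open>Asymptotic cones\<close>

definition cone_seqs :: "'a metric \<Rightarrow> 'a \<Rightarrow> (nat \<Rightarrow> real) \<Rightarrow> (nat \<Rightarrow> 'a) set" where
  "cone_seqs X x0 d =
     {x. (\<forall>n. x n \<in> mspace X) \<and> (\<exists>B. \<forall>n. mdist X x0 (x n) / d n \<le> B)}"

definition cone_rel ::
  "nat filter \<Rightarrow> 'a metric \<Rightarrow> 'a \<Rightarrow> (nat \<Rightarrow> real) \<Rightarrow> ((nat \<Rightarrow> 'a) \<times> (nat \<Rightarrow> 'a)) set" where
  "cone_rel \<omega> X x0 d =
     {(x, y). x \<in> cone_seqs X x0 d \<and> y \<in> cone_seqs X x0 d \<and>
              ((\<lambda>n. mdist X (x n) (y n) / d n) \<longlongrightarrow> 0) \<omega>}"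

definition cone_points ::
  "nat filter \<Rightarrow> 'a metric \<Rightarrow> 'a \<Rightarrow> (nat \<Rightarrow> real) \<Rightarrow> (nat \<Rightarrow> 'a) set set" where
  "cone_points \<omega> X x0 d = cone_seqs X x0 d // cone_rel \<omega> X x0 d"

definition cone_dist ::
  "nat filter \<Rightarrow> 'a metric \<Rightarrow> 'a \<Rightarrow> (nat \<Rightarrow> real)
     \<Rightarrow> (nat \<Rightarrow> 'a) set \<Rightarrow> (nat \<Rightarrow> 'a) set \<Rightarrow> real" where
  "cone_dist \<omega> X x0 d U V =
     (if U \<in> cone_points \<omega> X x0 d \<and> V \<in> cone_points \<omega> X x0 d
      then THE r. \<forall>x\<in>U. \<forall>y\<in>V. ((\<lambda>n. mdist X (x n) (y n) / d n) \<longlongrightarrow> r) \<omega>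
      else 0)"

definition asymptotic_cone ::
  "nat filter \<Rightarrow> 'a metric \<Rightarrow> 'a \<Rightarrow> (nat \<Rightarrow> real) \<Rightarrow> (nat \<Rightarrow> 'a) set metric" where
  "asymptotic_cone \<omega> X x0 d = metric (cone_points \<omega> X x0 d, cone_dist \<omega> X x0 d)"

subsection \<open>Real trees, products, bi-Lipschitz equivalence\<close>

definition geodesic_space :: "'a metric \<Rightarrow> bool" where
  "geodesic_space X \<longleftrightarrow>
     (\<forall>x\<in>mspace X. \<forall>y\<in>mspace X. \<exists>\<gamma> :: real \<Rightarrow> 'a.
        \<gamma> 0 = x \<and> \<gamma> (mdist X x y) = y \<and>
        (\<forall>s\<in>{0..mdist X x y}. \<gamma> s \<in> mspace X) \<and>
        (\<forall>s\<in>{0..mdist X x y}. \<forall>t\<in>{0..mdist X x y}. mdist X (\<gamma> s) (\<gamma> t) = \<bar>s - t\<bar>))"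

definition arcin :: "'a topology \<Rightarrow> (real \<Rightarrow> 'a) \<Rightarrow> bool" where
  "arcin T p \<longleftrightarrow> pathin T p \<and> inj_on p {0..1}"

text \<open>A real tree is a geodesic space in which the topological arc between two points is
  unique, as a set; existence of arcs is already part of geodesicity.\<close>

definition real_tree :: "'a metric \<Rightarrow> bool" where
  "real_tree X \<longleftrightarrow> geodesic_space X \<and>
     (\<forall>p q. arcin (mtopology_of X) p \<and> arcin (mtopology_of X) q \<and> p 0 = q 0 \<and> p 1 = q 1
        \<longrightarrow> p ` {0..1} = q ` {0..1})"

text \<open>The library's \<^const>\<open>prod_metric\<close> is the Euclidean product, not the sum.\<close>

definition sum_metric :: "'a metric \<Rightarrow> 'b metric \<Rightarrow> ('a \<times> 'b) metric" where
  "sum_metric X Y =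
     metric (mspace X \<times> mspace Y,
       \<lambda>p q. mdist X (fst p) (fst q) + mdist Y (snd p) (snd q))"

definition bilipschitz_equivalent :: "'a metric \<Rightarrow> 'b metric \<Rightarrow> bool" where
  "bilipschitz_equivalent X Y \<longleftrightarrow>
     (\<exists>f C. bij_betw f (mspace X) (mspace Y) \<and> C \<ge> 1 \<and>
        (\<forall>x\<in>mspace X. \<forall>y\<in>mspace X.
           mdist X x y / C \<le> mdist Y (f x) (f y) \<and> mdist Y (f x) (f y) \<le> C * mdist X x y))"

subsection \<open>The constructions above are metric spaces\<close>

text \<open>Since \<^typ>\<open>'a metric\<close> is a subtype, the definitions above made with \<^const>\<open>metric\<close>
  are only meaningful through the following facts.\<close>

lemma sum_metric_Metric_space:
  "Metric_space (mspace X \<times> mspace Y)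
     (\<lambda>p q. mdist X (fst p) (fst q) + mdist Y (snd p) (snd q))"
proof
  fix x y z
  assume "x \<in> mspace X \<times> mspace Y" "y \<in> mspace X \<times> mspace Y" "z \<in> mspace X \<times> mspace Y"
  then have "mdist X (fst x) (fst z) \<le> mdist X (fst x) (fst y) + mdist X (fst y) (fst z)"
    "mdist Y (snd x) (snd z) \<le> mdist Y (snd x) (snd y) + mdist Y (snd y) (snd z)"
    by (auto intro!: mdist_triangle)
  then show "mdist X (fst x) (fst z) + mdist Y (snd x) (snd z)
      \<le> mdist X (fst x) (fst y) + mdist Y (snd x) (snd y)
        + (mdist X (fst y) (fst z) + mdist Y (snd y) (snd z))"
    by linarith
qed (auto simp: mdist_commute add_nonneg_eq_0_iff)

lemma mspace_sum_metric [simp]: "mspace (sum_metric X Y) = mspace X \<times> mspace Y"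
  unfolding sum_metric_def by (rule Metric_space.mspace_metric[OF sum_metric_Metric_space])

lemma mdist_sum_metric [simp]:
  "mdist (sum_metric X Y) (x1, y1) (x2, y2) = mdist X x1 x2 + mdist Y y1 y2"
  unfolding sum_metric_def
  by (simp add: Metric_space.mdist_metric[OF sum_metric_Metric_space])

lemma ultrafilter_bounded_limit:
  fixes f :: "'a \<Rightarrow> real"
  assumes "ultrafilter \<omega>" "\<And>n. \<bar>f n\<bar> \<le> B"
  shows "\<exists>r. (f \<longlongrightarrow> r) \<omega>"
proof -
  let ?F = "filtermap f \<omega>"
  have bot: "?F \<noteq> bot"
    using assms by (simp add: ultrafilter_def filtermap_bot_iff)
  have "eventually (\<lambda>x. x \<in> {-B..B}) ?F"
    using assms(2) by (auto simp: eventually_filtermap abs_le_iff intro!: always_eventually)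
      (metis minus_le_iff)
  then obtain r where r: "inf (nhds r) ?F \<noteq> bot"
    using compact_Icc[of "-B" B] bot unfolding compact_filter by blast
  have "?F \<le> nhds r"
  proof (rule filter_leI)
    fix P assume P: "eventually P (nhds r)"
    show "eventually P ?F"
    proof (rule ccontr)
      assume "\<not> eventually P ?F"
      then have "eventually (\<lambda>x. \<not> P x) ?F"
        using assms(1) by (auto simp: ultrafilter_def eventually_filtermap)
      then have "eventually (\<lambda>x. False) (inf (nhds r) ?F)"
        using P unfolding eventually_inf by blast
      then show False using r by (simp add: eventually_False)
    qed
  qed
  then show ?thesis by (auto simp: filterlim_def)
qed

context
  fixes \<omega> :: "nat filter" and X :: "'a metric" and x0 :: 'a and d :: "nat \<Rightarrow> real"
  assumes \<omega>: "ultrafilter \<omega>" and d: "\<And>n. 0 < d n" and x0: "x0 \<in> mspace X"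
begin

private lemma limit_ex:
  assumes "x \<in> cone_seqs X x0 d" "y \<in> cone_seqs X x0 d"
  shows "\<exists>r. ((\<lambda>n. mdist X (x n) (y n) / d n) \<longlongrightarrow> r) \<omega>"
proof -
  obtain B C where x: "\<And>n. x n \<in> mspace X" "\<And>n. mdist X x0 (x n) / d n \<le> B"
    and y: "\<And>n. y n \<in> mspace X" "\<And>n. mdist X x0 (y n) / d n \<le> C"
    using assms by (auto simp: cone_seqs_def)
  show ?thesis
  proof (rule ultrafilter_bounded_limit[OF \<omega>])
    fix n
    have "mdist X (x n) (y n) \<le> mdist X x0 (x n) + mdist X x0 (y n)"
      using mdist_triangle[OF x(1)[of n] x0 y(1)[of n]] by (simp add: mdist_commute)
    then have "mdist X (x n) (y n) / d n \<le> mdist X x0 (x n) / d n + mdist X x0 (y n) / d n"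
      using d[of n] by (simp add: field_simps)
    then show "\<bar>mdist X (x n) (y n) / d n\<bar> \<le> B + C"
      using x(2)[of n] y(2)[of n] d[of n] by simp
  qed
qed

private lemma limit_triangle:
  assumes "x \<in> cone_seqs X x0 d" "y \<in> cone_seqs X x0 d" "z \<in> cone_seqs X x0 d"
    and "((\<lambda>n. mdist X (x n) (y n) / d n) \<longlongrightarrow> a) \<omega>"
    and "((\<lambda>n. mdist X (y n) (z n) / d n) \<longlongrightarrow> b) \<omega>"
    and "((\<lambda>n. mdist X (x n) (z n) / d n) \<longlongrightarrow> c) \<omega>"
  shows "c \<le> a + b"
proof (rule tendsto_le[OF _ tendsto_add[OF assms(4,5)] assms(6)])
  show "\<omega> \<noteq> bot" using \<omega> by (simp add: ultrafilter_def)
  have "mdist X (x n) (z n) / d n \<le> mdist X (x n) (y n) / d n + mdist X (y n) (z n) / d n" for n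
  proof -
    have "mdist X (x n) (z n) \<le> mdist X (x n) (y n) + mdist X (y n) (z n)"
      using assms(1-3) by (intro mdist_triangle) (auto simp: cone_seqs_def)
    then show ?thesis using d[of n] by (simp add: field_simps)
  qed
  then show "\<forall>\<^sub>F n in \<omega>. mdist X (x n) (z n) / d n
      \<le> mdist X (x n) (y n) / d n + mdist X (y n) (z n) / d n"
    by (intro always_eventually) simp
qed

private lemma limit_nonneg:
  assumes "((\<lambda>n. mdist X (x n) (y n) / d n) \<longlongrightarrow> a) \<omega>"
  shows "0 \<le> a"
  using \<omega> d by (intro tendsto_lowerbound[OF assms])
    (auto simp: ultrafilter_def less_imp_le intro!: always_eventually)

lemma equiv_cone_rel: "equiv (cone_seqs X x0 d) (cone_rel \<omega> X x0 d)"
proof (rule equivI)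
  show "cone_rel \<omega> X x0 d \<subseteq> cone_seqs X x0 d \<times> cone_seqs X x0 d"
    by (auto simp: cone_rel_def)
  show "refl_on (cone_seqs X x0 d) (cone_rel \<omega> X x0 d)"
  proof (rule refl_onI)
    fix x assume x: "x \<in> cone_seqs X x0 d"
    then have "mdist X (x n) (x n) = 0" for n by (simp add: cone_seqs_def)
    then show "(x, x) \<in> cone_rel \<omega> X x0 d" using x by (simp add: cone_rel_def)
  qed
  show "sym (cone_rel \<omega> X x0 d)"
    by (auto simp: sym_def cone_rel_def mdist_commute)
  show "trans (cone_rel \<omega> X x0 d)"
  proof (rule transI)
    fix x y z assume xy: "(x, y) \<in> cone_rel \<omega> X x0 d" and yz: "(y, z) \<in> cone_rel \<omega> X x0 d"
    then have s: "x \<in> cone_seqs X x0 d" "y \<in> cone_seqs X x0 d" "z \<in> cone_seqs X x0 d"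
      by (auto simp: cone_rel_def)
    obtain c where c: "((\<lambda>n. mdist X (x n) (z n) / d n) \<longlongrightarrow> c) \<omega>"
      using limit_ex[OF s(1,3)] by blast
    have "c \<le> 0 + 0"
      using xy yz by (intro limit_triangle[OF s _ _ c]) (auto simp: cone_rel_def)
    then have "c = 0" using limit_nonneg[OF c] by simp
    then show "(x, z) \<in> cone_rel \<omega> X x0 d" using c s by (simp add: cone_rel_def)
  qed
qed

lemma cone_dist_eq:
  assumes x: "x \<in> cone_seqs X x0 d" and y: "y \<in> cone_seqs X x0 d"
    and r: "((\<lambda>n. mdist X (x n) (y n) / d n) \<longlongrightarrow> r) \<omega>"
  shows "cone_dist \<omega> X x0 d (cone_rel \<omega> X x0 d `` {x}) (cone_rel \<omega> X x0 d `` {y}) = r"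
proof -
  let ?R = "cone_rel \<omega> X x0 d"
  have all: "((\<lambda>n. mdist X (u n) (v n) / d n) \<longlongrightarrow> r) \<omega>"
    if u: "(x, u) \<in> ?R" and v: "(y, v) \<in> ?R" for u v
  proof -
    have s: "u \<in> cone_seqs X x0 d" "v \<in> cone_seqs X x0 d"
      and lu: "((\<lambda>n. mdist X (x n) (u n) / d n) \<longlongrightarrow> 0) \<omega>"
      and lv: "((\<lambda>n. mdist X (y n) (v n) / d n) \<longlongrightarrow> 0) \<omega>"
      using u v by (auto simp: cone_rel_def)
    obtain c where c: "((\<lambda>n. mdist X (u n) (v n) / d n) \<longlongrightarrow> c) \<omega>"
      using limit_ex[OF s] by blast
    obtain e where e: "((\<lambda>n. mdist X (x n) (v n) / d n) \<longlongrightarrow> e) \<omega>"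
      using limit_ex[OF x s(2)] by blast
    have lu': "((\<lambda>n. mdist X (u n) (x n) / d n) \<longlongrightarrow> 0) \<omega>"
      and lv': "((\<lambda>n. mdist X (v n) (y n) / d n) \<longlongrightarrow> 0) \<omega>"
      using lu lv by (simp_all add: mdist_commute)
    have "e \<le> 0 + c" by (rule limit_triangle[OF x s lu c e])
    moreover have "c \<le> 0 + e" by (rule limit_triangle[OF s(1) x s(2) lu' e c])
    moreover have "r \<le> e + 0" by (rule limit_triangle[OF x s(2) y e lv' r])
    moreover have "e \<le> r + 0" by (rule limit_triangle[OF x y s(2) r lv e])
    ultimately have "c = r" by simp
    then show ?thesis using c by simp
  qed
  have refl: "(x, x) \<in> ?R" "(y, y) \<in> ?R"
    using equiv_cone_rel x y by (auto simp: equiv_def refl_on_def)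
  have "(THE r. \<forall>u\<in>?R `` {x}. \<forall>v\<in>?R `` {y}. ((\<lambda>n. mdist X (u n) (v n) / d n) \<longlongrightarrow> r) \<omega>) = r"
  proof (rule the_equality)
    fix s assume "\<forall>u\<in>?R `` {x}. \<forall>v\<in>?R `` {y}. ((\<lambda>n. mdist X (u n) (v n) / d n) \<longlongrightarrow> s) \<omega>"
    then have "((\<lambda>n. mdist X (x n) (y n) / d n) \<longlongrightarrow> s) \<omega>" using refl by blast
    then show "s = r" using r \<omega> tendsto_unique unfolding ultrafilter_def by blast
  qed (use all in blast)
  moreover have "?R `` {x} \<in> cone_points \<omega> X x0 d" "?R `` {y} \<in> cone_points \<omega> X x0 d"
    using x y by (auto simp: cone_points_def quotientI)
  ultimately show ?thesis by (simp add: cone_dist_def)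
qed

lemma cone_Metric_space: "Metric_space (cone_points \<omega> X x0 d) (cone_dist \<omega> X x0 d)"
proof
  let ?R = "cone_rel \<omega> X x0 d"
  have rep: "\<exists>x\<in>cone_seqs X x0 d. U = ?R `` {x}" if "U \<in> cone_points \<omega> X x0 d" for U
    using that by (auto simp: cone_points_def quotient_def)
  fix U V W
  have sym: "(THE r. \<forall>x\<in>U. \<forall>y\<in>V. ((\<lambda>n. mdist X (x n) (y n) / d n) \<longlongrightarrow> r) \<omega>)
    = (THE r. \<forall>x\<in>V. \<forall>y\<in>U. ((\<lambda>n. mdist X (x n) (y n) / d n) \<longlongrightarrow> r) \<omega>)"
  proof -
    have "(\<lambda>n. mdist X (x n) (y n) / d n) = (\<lambda>n. mdist X (y n) (x n) / d n)" for x y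
      by (simp add: mdist_commute)
    then have "(\<forall>x\<in>U. \<forall>y\<in>V. ((\<lambda>n. mdist X (x n) (y n) / d n) \<longlongrightarrow> r) \<omega>)
      \<longleftrightarrow> (\<forall>x\<in>V. \<forall>y\<in>U. ((\<lambda>n. mdist X (x n) (y n) / d n) \<longlongrightarrow> r) \<omega>)" for r
      by (auto 0 3)
    then show ?thesis by simp
  qed
  then show "cone_dist \<omega> X x0 d U V = cone_dist \<omega> X x0 d V U"
    by (simp add: cone_dist_def)
  show "0 \<le> cone_dist \<omega> X x0 d U V"
  proof (cases "U \<in> cone_points \<omega> X x0 d \<and> V \<in> cone_points \<omega> X x0 d")
    case True
    then obtain x y where x: "x \<in> cone_seqs X x0 d" "U = ?R `` {x}"
      and y: "y \<in> cone_seqs X x0 d" "V = ?R `` {y}"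
      using rep by blast
    obtain r where r: "((\<lambda>n. mdist X (x n) (y n) / d n) \<longlongrightarrow> r) \<omega>"
      using limit_ex[OF x(1) y(1)] by blast
    show ?thesis using cone_dist_eq[OF x(1) y(1) r] limit_nonneg[OF r] x y by simp
  qed (auto simp: cone_dist_def)
  assume U: "U \<in> cone_points \<omega> X x0 d" and V: "V \<in> cone_points \<omega> X x0 d"
  obtain x y where x: "x \<in> cone_seqs X x0 d" "U = ?R `` {x}"
    and y: "y \<in> cone_seqs X x0 d" "V = ?R `` {y}"
    using rep U V by blast
  obtain r where r: "((\<lambda>n. mdist X (x n) (y n) / d n) \<longlongrightarrow> r) \<omega>"
    using limit_ex[OF x(1) y(1)] by blast
  have UV: "cone_dist \<omega> X x0 d U V = r" using cone_dist_eq[OF x(1) y(1) r] x y by simp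
  have "(U = V) = ((x, y) \<in> ?R)"
    using eq_equiv_class_iff[OF equiv_cone_rel x(1) y(1)] x y by simp
  also have "\<dots> = (r = 0)"
  proof
    assume "(x, y) \<in> ?R"
    then have "((\<lambda>n. mdist X (x n) (y n) / d n) \<longlongrightarrow> 0) \<omega>" by (simp add: cone_rel_def)
    moreover have "\<omega> \<noteq> bot" using \<omega> by (simp add: ultrafilter_def)
    ultimately show "r = 0" using r tendsto_unique by blast
  next
    assume "r = 0"
    then show "(x, y) \<in> ?R" using r x(1) y(1) by (simp add: cone_rel_def)
  qed
  finally show "cone_dist \<omega> X x0 d U V = 0 \<longleftrightarrow> U = V" using UV by simp
  assume W: "W \<in> cone_points \<omega> X x0 d"
  obtain z where z: "z \<in> cone_seqs X x0 d" "W = ?R `` {z}" using rep W by blast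
  obtain s where s: "((\<lambda>n. mdist X (y n) (z n) / d n) \<longlongrightarrow> s) \<omega>"
    using limit_ex[OF y(1) z(1)] by blast
  obtain t where t: "((\<lambda>n. mdist X (x n) (z n) / d n) \<longlongrightarrow> t) \<omega>"
    using limit_ex[OF x(1) z(1)] by blast
  show "cone_dist \<omega> X x0 d U W \<le> cone_dist \<omega> X x0 d U V + cone_dist \<omega> X x0 d V W"
    using limit_triangle[OF x(1) y(1) z(1) r s t] UV cone_dist_eq[OF y(1) z(1) s]
      cone_dist_eq[OF x(1) z(1) t] x y z by simp
qed

lemma mspace_asymptotic_cone: "mspace (asymptotic_cone \<omega> X x0 d) = cone_points \<omega> X x0 d"
  unfolding asymptotic_cone_def by (rule Metric_space.mspace_metric[OF cone_Metric_space])

lemma mdist_asymptotic_cone: "mdist (asymptotic_cone \<omega> X x0 d) = cone_dist \<omega> X x0 d"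
  unfolding asymptotic_cone_def by (rule Metric_space.mdist_metric[OF cone_Metric_space])

end

context
  fixes G :: "('a, 'b) monoid_scheme" (structure) and S :: "'a set"
  assumes group: "group G" and S: "S \<subseteq> carrier G"
begin

interpretation group G by (rule group)

private abbreviation "letters \<equiv> S \<union> m_inv G ` S"

private lemma letters: "letters \<subseteq> carrier G" using S by auto

private lemma word_closed: "set ws \<subseteq> letters \<Longrightarrow> foldr (\<otimes>) ws \<one> \<in> carrier G"
  using letters by (induction ws) auto

private lemma word_append:
  "set us \<subseteq> letters \<Longrightarrow> set vs \<subseteq> letters \<Longrightarrow>
    foldr (\<otimes>) (us @ vs) \<one> = foldr (\<otimes>) us \<one> \<otimes> foldr (\<otimes>) vs \<one>"
proof (induction us)
  case Nil
  then show ?case using word_closed[of vs] by simp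
next
  case (Cons a us)
  have "a \<in> carrier G" using Cons.prems letters by auto
  then show ?case using Cons word_closed[of us] word_closed[of vs] by (simp add: m_assoc)
qed

private lemma letters_inv: "a \<in> letters \<Longrightarrow> m_inv G a \<in> letters"
  using S by (auto simp: image_iff)

private lemma word_inv:
  "set ws \<subseteq> letters \<Longrightarrow>
    \<exists>vs. set vs \<subseteq> letters \<and> length vs = length ws \<and> foldr (\<otimes>) vs \<one> = m_inv G (foldr (\<otimes>) ws \<one>)"
proof (induction ws)
  case Nil
  show ?case by simp
next
  case (Cons a ws)
  then obtain vs where vs: "set vs \<subseteq> letters" "length vs = length ws"
    "foldr (\<otimes>) vs \<one> = m_inv G (foldr (\<otimes>) ws \<one>)" by auto
  have a: "a \<in> letters" and ac: "a \<in> carrier G" using Cons.prems letters by auto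
  have ia: "m_inv G a \<in> letters" by (rule letters_inv[OF a])
  have "foldr (\<otimes>) (vs @ [m_inv G a]) \<one> = foldr (\<otimes>) vs \<one> \<otimes> foldr (\<otimes>) [m_inv G a] \<one>"
    by (rule word_append) (use vs ia in auto)
  also have "\<dots> = m_inv G (foldr (\<otimes>) (a # ws) \<one>)"
    using vs ac word_closed[of ws] Cons.prems by (simp add: inv_mult_group)
  finally show ?case using vs ia by (intro exI[of _ "vs @ [m_inv G a]"]) auto
qed

private lemma word_ex:
  "g \<in> generate G S \<Longrightarrow> \<exists>ws. set ws \<subseteq> letters \<and> foldr (\<otimes>) ws \<one> = g"
proof (induction rule: generate.induct)
  case one
  show ?case by (intro exI[of _ "[]"]) simp
next
  case (incl h)
  then show ?case using S by (intro exI[of _ "[h]"]) auto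
next
  case (inv h)
  then show ?case using S by (intro exI[of _ "[m_inv G h]"]) auto
next
  case (eng g h)
  then obtain us vs where "set us \<subseteq> letters" "foldr (\<otimes>) us \<one> = g"
    "set vs \<subseteq> letters" "foldr (\<otimes>) vs \<one> = h" by blast
  then show ?case using word_append[of us vs] by (intro exI[of _ "us @ vs"]) auto
qed

private lemma word_length_le:
  "set ws \<subseteq> letters \<Longrightarrow> word_length G S (foldr (\<otimes>) ws \<one>) \<le> length ws"
  unfolding word_length_def by (rule Least_le) blast

context
  assumes gen: "generate G S = carrier G"
begin

private lemma word_length_attained:
  assumes "g \<in> carrier G"
  shows "\<exists>ws. set ws \<subseteq> letters \<and> length ws = word_length G S g \<and> foldr (\<otimes>) ws \<one> = g"
proof -
  have "\<exists>n ws. set ws \<subseteq> letters \<and> length ws = n \<and> foldr (\<otimes>) ws \<one> = g"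
    using word_ex assms gen by auto
  then show ?thesis unfolding word_length_def by (rule LeastI_ex)
qed

private lemma word_length_inv_le:
  assumes "g \<in> carrier G"
  shows "word_length G S (m_inv G g) \<le> word_length G S g"
proof -
  obtain ws where ws: "set ws \<subseteq> letters" "length ws = word_length G S g" "foldr (\<otimes>) ws \<one> = g"
    using word_length_attained[OF assms] by blast
  then show ?thesis using word_inv[OF ws(1)] word_length_le by metis
qed

private lemma word_length_mult_le:
  assumes "g \<in> carrier G" "h \<in> carrier G"
  shows "word_length G S (g \<otimes> h) \<le> word_length G S g + word_length G S h"
proof -
  obtain us vs where us: "set us \<subseteq> letters" "length us = word_length G S g" "foldr (\<otimes>) us \<one> = g"
    and vs: "set vs \<subseteq> letters" "length vs = word_length G S h" "foldr (\<otimes>) vs \<one> = h"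
    using word_length_attained[OF assms(1)] word_length_attained[OF assms(2)] by blast
  then show ?thesis using word_length_le[of "us @ vs"] word_append[of us vs] by simp
qed

private lemma word_length_0:
  assumes "g \<in> carrier G"
  shows "word_length G S g = 0 \<longleftrightarrow> g = \<one>"
  using word_length_attained[OF assms] word_length_le[of "[]"] by auto

lemma word_metric_Metric_space:
  "Metric_space (carrier G)
     (\<lambda>g h. if g \<in> carrier G \<and> h \<in> carrier G
            then real (word_length G S (m_inv G g \<otimes> h)) else 0)"
proof
  fix g h k
  have le: "word_length G S (m_inv G g \<otimes> h) \<le> word_length G S (m_inv G h \<otimes> g)"
    if "g \<in> carrier G" "h \<in> carrier G" for g h
    using word_length_inv_le[of "m_inv G h \<otimes> g"] that by (simp add: inv_mult_group)
  show "(if g \<in> carrier G \<and> h \<in> carrier G then real (word_length G S (m_inv G g \<otimes> h)) else 0)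
      = (if h \<in> carrier G \<and> g \<in> carrier G then real (word_length G S (m_inv G h \<otimes> g)) else 0)"
    using le[of g h] le[of h g] by auto
  assume g: "g \<in> carrier G" and h: "h \<in> carrier G"
  have "m_inv G g \<otimes> h = \<one> \<longleftrightarrow> g = h"
    using g h inv_solve_left'[of "\<one>" g h] by auto
  then show "(if g \<in> carrier G \<and> h \<in> carrier G then real (word_length G S (m_inv G g \<otimes> h)) else 0) = 0
      \<longleftrightarrow> g = h"
    using g h word_length_0[of "m_inv G g \<otimes> h"] by simp
  assume k: "k \<in> carrier G"
  have "h \<otimes> (m_inv G h \<otimes> k) = k"
    using h k by (simp add: m_assoc[symmetric])
  then have "m_inv G g \<otimes> k = (m_inv G g \<otimes> h) \<otimes> (m_inv G h \<otimes> k)"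
    using g h k by (simp add: m_assoc)
  then have "word_length G S (m_inv G g \<otimes> k)
      \<le> word_length G S (m_inv G g \<otimes> h) + word_length G S (m_inv G h \<otimes> k)"
    using word_length_mult_le[of "m_inv G g \<otimes> h" "m_inv G h \<otimes> k"] g h k by simp
  then show "(if g \<in> carrier G \<and> k \<in> carrier G then real (word_length G S (m_inv G g \<otimes> k)) else 0)
      \<le> (if g \<in> carrier G \<and> h \<in> carrier G then real (word_length G S (m_inv G g \<otimes> h)) else 0)
        + (if h \<in> carrier G \<and> k \<in> carrier G then real (word_length G S (m_inv G h \<otimes> k)) else 0)"
    using g h k by simp
qed simp

lemma mspace_word_metric: "mspace (word_metric G S) = carrier G"
  unfolding word_metric_def by (rule Metric_space.mspace_metric[OF word_metric_Metric_space])

lemma mdist_word_metric: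
  "g \<in> carrier G \<Longrightarrow> h \<in> carrier G \<Longrightarrow>
    mdist (word_metric G S) g h = real (word_length G S (m_inv G g \<otimes> h))"
  unfolding word_metric_def
  by (simp add: Metric_space.mdist_metric[OF word_metric_Metric_space])

end

end

lemma generate_quotient:
  assumes "N \<lhd> G" "S \<subseteq> carrier G" "generate G S = carrier G"
  shows "generate (G Mod N) ((\<lambda>g. N #>\<^bsub>G\<^esub> g) ` S) = carrier (G Mod N)"
proof -
  interpret normal N G by fact
  interpret h: group_hom G "G Mod N" "\<lambda>g. N #>\<^bsub>G\<^esub> g"
    using r_coset_hom_Mod factorgroup_is_group
    by (simp add: group_hom_def group_hom_axioms_def is_group)
  have "(\<lambda>g. N #>\<^bsub>G\<^esub> g) ` generate G S = generate (G Mod N) ((\<lambda>g. N #>\<^bsub>G\<^esub> g) ` S)"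
    by (rule h.generate_img[OF assms(2), symmetric])
  moreover have "carrier (G Mod N) = (\<lambda>g. N #>\<^bsub>G\<^esub> g) ` carrier G"
    by (auto simp: FactGroup_def RCOSETS_def)
  ultimately show ?thesis using assms(3) by simp
qed

end

theory Submission
  imports Defs
begin

text \<open>The map \<open>\<pi>\<close> from the cone of \<open>G\<close> to the cone \<open>T\<close> of \<open>G/N\<close> is 1-Lipschitz, and its fibres are the
  orbits of an isometric action of the cone of \<open>N\<close>; centrality makes every orbit map isometric. A
  minimal-length lift of a word shows that each point of \<open>T\<close> has a lift at minimal distance from any
  given point. Hence geodesics of the tree \<open>T\<close> lift isometrically, and since the cone of \<open>G\<close> is
  complete and geodesic, Zorn's lemma gives an isometric section \<open>\<sigma>\<close> of \<open>\<pi>\<close>: a partial section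
  over a subset that is star-shaped about a base point can be extended along a lifted geodesic,
  because geodesics of a tree that leave such a subset never come back. Then
  \<open>(a, t) \<mapsto> a \<cdot> \<sigma> t\<close> is bi-Lipschitz.\<close>

subsection \<open>Geodesics and sections in real trees\<close>

text \<open>Lifting the geodesic to each point of the tree separately does not give a section: over
  a common initial segment two lifts may differ by elements of the cone of \<open>N\<close>.
  Enlarging one partial section forces the choices to agree. Once they agree, isometry follows from
  two opposite bounds: upstairs, the triangle inequality through the exit point bounds a distance by
  the distance in the tree, and the 1-Lipschitz projection gives the converse. Completeness carries
  a partial section to an exit time at which it need not be defined yet. The properties used of the
  projection are the same for \<open>G\<close> over \<open>G Mod N\<close> and for their cones.
  \<open>orbit_fibration\<close> states them once; they pass to the cones along representing
  sequences, and the tree is used only there.\<close>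

definition geodesic_segment :: "'a metric \<Rightarrow> (real \<Rightarrow> 'a) \<Rightarrow> real \<Rightarrow> bool" where
  "geodesic_segment X \<gamma> l \<longleftrightarrow> \<gamma> ` {0..l} \<subseteq> mspace X \<and>
     (\<forall>s\<in>{0..l}. \<forall>t\<in>{0..l}. mdist X (\<gamma> s) (\<gamma> t) = \<bar>s - t\<bar>)"

lemma geodesic_segment_in: "geodesic_segment X \<gamma> l \<Longrightarrow> 0 \<le> s \<Longrightarrow> s \<le> l \<Longrightarrow> \<gamma> s \<in> mspace X"
  by (auto simp: geodesic_segment_def)

lemma geodesic_segment_dist:
  "geodesic_segment X \<gamma> l \<Longrightarrow> 0 \<le> s \<Longrightarrow> s \<le> l \<Longrightarrow> 0 \<le> t \<Longrightarrow> t \<le> l \<Longrightarrow>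
    mdist X (\<gamma> s) (\<gamma> t) = \<bar>s - t\<bar>"
  by (auto simp: geodesic_segment_def)

lemma geodesic_space_segment:
  assumes "geodesic_space X" "x \<in> mspace X" "y \<in> mspace X"
  obtains \<gamma> where "geodesic_segment X \<gamma> (mdist X x y)" "\<gamma> 0 = x" "\<gamma> (mdist X x y) = y"
proof -
  obtain \<gamma> where "\<gamma> 0 = x" "\<gamma> (mdist X x y) = y"
    "\<forall>s\<in>{0..mdist X x y}. \<gamma> s \<in> mspace X"
    "\<forall>s\<in>{0..mdist X x y}. \<forall>t\<in>{0..mdist X x y}. mdist X (\<gamma> s) (\<gamma> t) = \<bar>s - t\<bar>"
    using assms unfolding geodesic_space_def by blast
  then show ?thesis by (intro that[of \<gamma>]) (simp_all add: geodesic_segment_def image_subset_iff)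
qed

text \<open>Uniqueness of arcs in \<open>real_tree\<close> is stated on the unit interval, whereas
  the paths built below live on arbitrary intervals. The affine substitution makes a 1-Lipschitz
  path \<open>(b - a)\<close>-Lipschitz, hence continuous.\<close>

lemma arcin_affine:
  fixes h :: "real \<Rightarrow> 'a"
  assumes "a < b" "h ` {a..b} \<subseteq> mspace X" "inj_on h {a..b}"
    and lip: "\<And>s t. s \<in> {a..b} \<Longrightarrow> t \<in> {a..b} \<Longrightarrow> mdist X (h s) (h t) \<le> \<bar>s - t\<bar>"
  shows "arcin (mtopology_of X) (\<lambda>\<tau>. h (a + \<tau> * (b - a)))"
    and "(\<lambda>\<tau>. h (a + \<tau> * (b - a))) ` {0..1} = h ` {a..b}"
proof -
  let ?p = "\<lambda>\<tau>. h (a + \<tau> * (b - a))"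
  have mem: "a + \<tau> * (b - a) \<in> {a..b}" if "\<tau> \<in> {0..1}" for \<tau>
    using that \<open>a < b\<close> mult_left_le_one_le[of "b - a" \<tau>] mult_nonneg_nonneg[of \<tau> "b - a"]
    unfolding atLeastAtMost_iff by linarith
  have "Lipschitz_continuous_map (submetric euclidean_metric {0..1}) X ?p"
    unfolding Lipschitz_continuous_map_def
  proof (intro conjI exI[of _ "b - a"] ballI)
    show "?p \<in> mspace (submetric euclidean_metric {0..1}) \<rightarrow> mspace X"
      using mem assms(2) by fastforce
    fix s t :: real
    assume "s \<in> mspace (submetric euclidean_metric {0..1})"
      "t \<in> mspace (submetric euclidean_metric {0..1})"
    then have "mdist X (?p s) (?p t) \<le> \<bar>(a + s * (b - a)) - (a + t * (b - a))\<bar>"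
      using mem by (intro lip) auto
    also have "\<dots> = \<bar>(b - a) * (s - t)\<bar>" by (simp add: algebra_simps)
    also have "\<dots> = (b - a) * \<bar>s - t\<bar>" using \<open>a < b\<close> by (simp add: abs_mult)
    finally show "mdist X (?p s) (?p t) \<le> (b - a) * mdist (submetric euclidean_metric {0..1}) s t"
      by (simp add: dist_real_def)
  qed
  then have "continuous_map (mtopology_of (submetric euclidean_metric {0..1})) (mtopology_of X) ?p"
    by (rule Lipschitz_continuous_imp_continuous_map)
  then have "pathin (mtopology_of X) ?p"
    by (simp add: pathin_def mtopology_of_submetric)
  moreover have "inj_on ?p {0..1}"
  proof (rule inj_onI)
    fix s t assume "s \<in> {0..1}" "t \<in> {0..1}" "?p s = ?p t"
    then have "a + s * (b - a) = a + t * (b - a)"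
      using inj_onD[OF assms(3)] mem by blast
    then show "s = t" using \<open>a < b\<close> by simp
  qed
  ultimately show "arcin (mtopology_of X) ?p" by (simp add: arcin_def)
  show "?p ` {0..1} = h ` {a..b}"
  proof
    show "?p ` {0..1} \<subseteq> h ` {a..b}" using mem by blast
    show "h ` {a..b} \<subseteq> ?p ` {0..1}"
    proof
      fix y assume "y \<in> h ` {a..b}"
      then obtain s where s: "s \<in> {a..b}" "y = h s" by blast
      then have "(s - a) / (b - a) \<in> {0..1}" "y = ?p ((s - a) / (b - a))"
        using \<open>a < b\<close> by auto
      then show "y \<in> ?p ` {0..1}" by blast
    qed
  qed
qed

text \<open>The geodesic from \<open>h a\<close> to \<open>h b\<close> is an arc with the same ends,
  so it has the same image as \<open>h\<close>. Thus \<open>h c\<close> lies on a geodesic, along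
  which distances add.\<close>

lemma real_tree_arc_in_geodesic:
  fixes h :: "real \<Rightarrow> 'a"
  assumes T: "real_tree X" and ab: "a < b"
    and h: "h ` {a..b} \<subseteq> mspace X" "inj_on h {a..b}"
      "\<And>s t. s \<in> {a..b} \<Longrightarrow> t \<in> {a..b} \<Longrightarrow> mdist X (h s) (h t) \<le> \<bar>s - t\<bar>"
    and c: "c \<in> {a..b}"
  shows "mdist X (h a) (h b) = mdist X (h a) (h c) + mdist X (h c) (h b)"
proof -
  let ?l = "mdist X (h a) (h b)"
  have in_X: "h a \<in> mspace X" "h b \<in> mspace X" using h(1) ab by auto
  obtain \<gamma> where \<gamma>: "geodesic_segment X \<gamma> ?l" "\<gamma> 0 = h a" "\<gamma> ?l = h b"
    using geodesic_space_segment[OF _ in_X] T by (auto simp: real_tree_def)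
  have "h a \<noteq> h b" using inj_onD[OF h(2), of a b] ab by auto
  then have l: "0 < ?l"
    using in_X mdist_zero[of "h a" X "h b"] mdist_nonneg[of X "h a" "h b"] by linarith
  have \<gamma>_inj: "inj_on \<gamma> {0..?l}"
  proof (rule inj_onI)
    fix s t assume "s \<in> {0..?l}" "t \<in> {0..?l}" "\<gamma> s = \<gamma> t"
    then show "s = t"
      using geodesic_segment_dist[OF \<gamma>(1), of s t] geodesic_segment_in[OF \<gamma>(1), of t]
        mdist_zero[of "\<gamma> t" X "\<gamma> t"] by simp
  qed
  have \<gamma>_lip: "mdist X (\<gamma> s) (\<gamma> t) \<le> \<bar>s - t\<bar>" if "s \<in> {0..?l}" "t \<in> {0..?l}" for s t
    using geodesic_segment_dist[OF \<gamma>(1)] that by simp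
  have \<gamma>_sub: "\<gamma> ` {0..?l} \<subseteq> mspace X" using \<gamma>(1) by (simp add: geodesic_segment_def)
  let ?p = "\<lambda>\<tau>. h (a + \<tau> * (b - a))"
  let ?q = "\<lambda>\<tau>. \<gamma> (0 + \<tau> * (?l - 0))"
  have p: "arcin (mtopology_of X) ?p" "?p ` {0..1} = h ` {a..b}"
    by (rule arcin_affine[OF ab h(1,2)], use h(3) in blast)+
  have q: "arcin (mtopology_of X) ?q" "?q ` {0..1} = \<gamma> ` {0..?l}"
    by (rule arcin_affine[OF l \<gamma>_sub \<gamma>_inj], use \<gamma>_lip in blast)+
  have "?p 0 = ?q 0" "?p 1 = ?q 1" using \<gamma>(2,3) by simp_all
  then have "?p ` {0..1} = ?q ` {0..1}"
    using T p(1) q(1) unfolding real_tree_def by blast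
  then have "h ` {a..b} = \<gamma> ` {0..?l}"
    using p(2) q(2) by simp
  then obtain s where s: "s \<in> {0..?l}" "h c = \<gamma> s" using c by blast
  then show ?thesis
    using geodesic_segment_dist[OF \<gamma>(1), of 0 s] geodesic_segment_dist[OF \<gamma>(1), of s ?l] \<gamma>(2,3) l
    by simp
qed

text \<open>Points shared by two geodesics from one origin are reached at the same time, so there is
  a last common time \<open>u\<close>. Beyond it the two rays form an arc through the branch point,
  and distances add along that arc.\<close>

lemma real_tree_branch:
  assumes T: "real_tree X" and \<gamma>: "geodesic_segment X \<gamma> l" and \<delta>: "geodesic_segment X \<delta> m"
    and o: "\<gamma> 0 = \<delta> 0" and "0 \<le> l" "0 \<le> m"
  obtains u where "0 \<le> u" "u \<le> l" "u \<le> m" "\<gamma> u = \<delta> u"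
    "\<And>s t. u \<le> s \<Longrightarrow> s \<le> l \<Longrightarrow> u \<le> t \<Longrightarrow> t \<le> m \<Longrightarrow> mdist X (\<gamma> s) (\<delta> t) = (s - u) + (t - u)"
proof -
  define A where "A = {s. 0 \<le> s \<and> s \<le> l \<and> s \<le> m \<and> \<gamma> s = \<delta> s}"
  define u where "u = Sup A"
  have A0: "0 \<in> A" using o \<open>0 \<le> l\<close> \<open>0 \<le> m\<close> by (simp add: A_def)
  have bdd: "bdd_above A" by (auto simp: A_def intro!: bdd_aboveI[of _ l])
  have A_le: "s \<le> u" if "s \<in> A" for s using cSup_upper[OF that bdd] by (simp add: u_def)
  have u: "0 \<le> u" "u \<le> l" "u \<le> m"
    using A_le[OF A0] A0 by (auto simp: u_def A_def intro!: cSup_least)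
  note in_X = geodesic_segment_in[OF \<gamma>] geodesic_segment_in[OF \<delta>]
  \<comment> \<open>The supremum is attained: common times \<open>s\<close> come within
    \<open>e / 2\<close> of \<open>u\<close>, and each geodesic moves by only \<open>u - s\<close>
    from there.\<close>
  have "mdist X (\<gamma> u) (\<delta> u) \<le> 0 + e" if "e > 0" for e
  proof -
    have below: "u - e / 2 < Sup A" using that by (simp add: u_def)
    obtain s where s: "s \<in> A" "u - e / 2 < s"
      using less_cSup_iff[OF _ bdd] A0 below by blast
    have "s \<le> u" using A_le s by blast
    have s': "0 \<le> s" "s \<le> l" "s \<le> m" "\<gamma> s = \<delta> s" using s by (auto simp: A_def)
    have "mdist X (\<gamma> u) (\<delta> u) \<le> mdist X (\<gamma> u) (\<gamma> s) + mdist X (\<gamma> s) (\<delta> u)"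
      using in_X u s' by (intro mdist_triangle) auto
    also have "\<dots> = \<bar>u - s\<bar> + \<bar>s - u\<bar>"
      using geodesic_segment_dist[OF \<gamma>, of u s] geodesic_segment_dist[OF \<delta>, of s u] u s' by simp
    finally show ?thesis using s \<open>s \<le> u\<close> by simp
  qed
  then have "mdist X (\<gamma> u) (\<delta> u) \<le> 0" by (rule field_le_epsilon)
  then have eq: "\<gamma> u = \<delta> u"
    using in_X u by (metis mdist_nonneg mdist_zero order_antisym)
  have dist: "mdist X (\<gamma> s) (\<delta> t) = (s - u) + (t - u)"
    if s: "u \<le> s" "s \<le> l" and t: "u \<le> t" "t \<le> m" for s t
  \<comment> \<open>If both rays are degenerate, the joined path is a single point and
    \<open>real_tree_arc_in_geodesic\<close>, which needs \<open>a < b\<close>, does not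
    apply.\<close>
  proof (cases "s = u \<and> t = u")
    case True
    then show ?thesis using eq in_X u by simp
  next
    case False
    \<comment> \<open>run along \<open>\<gamma>\<close> back to the branch point, then along \<open>\<delta>\<close>\<close>
    define h where "h \<tau> = (if \<tau> \<le> 0 then \<gamma> (u - \<tau>) else \<delta> (u + \<tau>))" for \<tau>
    let ?a = "u - s" and ?b = "t - u"
    have h\<gamma>: "h \<tau> = \<gamma> (u - \<tau>)" if "\<tau> \<le> 0" for \<tau> using that by (simp add: h_def)
    have h\<delta>: "h \<tau> = \<delta> (u + \<tau>)" if "0 \<le> \<tau>" for \<tau> using that eq by (cases "\<tau> = 0") (auto simp: h_def)
    have d\<gamma>: "mdist X (h x) (h y) = \<bar>x - y\<bar>" if "x \<in> {?a..0}" "y \<in> {?a..0}" for x y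
      using that s u by (simp add: h\<gamma> geodesic_segment_dist[OF \<gamma>])
    have d\<delta>: "mdist X (h x) (h y) = \<bar>x - y\<bar>" if "x \<in> {0..?b}" "y \<in> {0..?b}" for x y
      using that t u by (simp add: h\<delta> geodesic_segment_dist[OF \<delta>])
    have sub: "h x \<in> mspace X" if "x \<in> {?a..?b}" for x
      using that s t u in_X by (auto simp: h_def)
    have lip1: "mdist X (h x) (h y) \<le> \<bar>x - y\<bar>" if "x \<in> {?a..0}" "y \<in> {0..?b}" for x y
    proof -
      have "mdist X (h x) (h y) \<le> mdist X (h x) (h 0) + mdist X (h 0) (h y)"
        using that s t by (intro mdist_triangle sub) auto
      then show ?thesis using d\<gamma>[of x 0] d\<delta>[of 0 y] that s t by auto
    qed
    have lip: "mdist X (h x) (h y) \<le> \<bar>x - y\<bar>" if "x \<in> {?a..?b}" "y \<in> {?a..?b}" for x y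
      using that d\<gamma>[of x y] d\<delta>[of x y] lip1[of x y] lip1[of y x] mdist_commute[of X "h x" "h y"]
      by (cases "x \<le> 0"; cases "y \<le> 0") auto
    \<comment> \<open>Equal points have equal distance to the origin, which forces the common time
      \<open>u + y\<close>, past the last one.\<close>
    have neq: "h x \<noteq> h y" if "x \<in> {?a..0}" "y \<in> {0<..?b}" for x y
    proof
      assume eq': "h x = h y"
      have "mdist X (h x) (\<gamma> 0) = u - x"
        using that s u by (simp add: h\<gamma> geodesic_segment_dist[OF \<gamma>])
      moreover have "mdist X (h y) (\<delta> 0) = u + y"
        using that t u by (simp add: h\<delta> geodesic_segment_dist[OF \<delta>])
      ultimately have "x = - y" using eq' o by simp
      then have "\<gamma> (u + y) = \<delta> (u + y)" using eq' that by (simp add: h\<gamma> h\<delta>)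
      then have "u + y \<in> A" using that \<open>x = - y\<close> s t u by (auto simp: A_def)
      then show False using A_le[of "u + y"] that by simp
    qed
    have "inj_on h {?a..?b}"
    proof (rule inj_onI)
      fix x y assume xy: "x \<in> {?a..?b}" "y \<in> {?a..?b}" "h x = h y"
      have "mdist X (h x) (h y) = 0" using xy sub by simp
      then show "x = y"
        using xy d\<gamma>[of x y] d\<delta>[of x y] neq[of x y] neq[of y x]
        by (cases "x \<le> 0"; cases "y \<le> 0") auto
    qed
    then have "mdist X (h ?a) (h ?b) = mdist X (h ?a) (h 0) + mdist X (h 0) (h ?b)"
      using s t False sub lip by (intro real_tree_arc_in_geodesic[OF T]) auto
    also have "\<dots> = (s - u) + (t - u)"
      using s t d\<gamma>[of ?a 0] d\<delta>[of 0 ?b] by simp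
    finally show ?thesis using h\<gamma>[of ?a] h\<delta>[of ?b] s t by simp
  qed
  show ?thesis by (rule that[OF u eq dist])
qed

text \<open>Let a geodesic to \<open>t\<close> branch off from \<gamma> at time \<open>u\<close>,
  and let \<open>m\<close> be its length. The distance from \<open>\<gamma> s\<close> to
  \<open>t\<close> is then \<open>(s - u) + (m - u)\<close>; betweenness makes it
  \<open>s - m\<close>, so \<open>m = u\<close> and \<open>t\<close> is the branch point.\<close>

lemma real_tree_between:
  assumes T: "real_tree X" and \<gamma>: "geodesic_segment X \<gamma> l"
    and s: "0 \<le> s" "s \<le> l" and t: "t \<in> mspace X"
    and btw: "mdist X (\<gamma> 0) t + mdist X t (\<gamma> s) = s"
  shows "t = \<gamma> (mdist X (\<gamma> 0) t)"
proof -
  let ?m = "mdist X (\<gamma> 0) t"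
  have "\<gamma> 0 \<in> mspace X" using geodesic_segment_in[OF \<gamma>] s by simp
  then obtain \<delta> where \<delta>: "geodesic_segment X \<delta> ?m" "\<delta> 0 = \<gamma> 0" "\<delta> ?m = t"
    using geodesic_space_segment[OF _ _ t] T by (auto simp: real_tree_def)
  have "0 \<le> l" "0 \<le> ?m" using s by auto
  obtain u where u: "0 \<le> u" "u \<le> l" "u \<le> ?m" "\<gamma> u = \<delta> u"
    "\<And>s t. u \<le> s \<Longrightarrow> s \<le> l \<Longrightarrow> u \<le> t \<Longrightarrow> t \<le> ?m \<Longrightarrow> mdist X (\<gamma> s) (\<delta> t) = (s - u) + (t - u)"
    by (rule real_tree_branch[OF T \<gamma> \<delta>(1) \<delta>(2)[symmetric] \<open>0 \<le> l\<close> \<open>0 \<le> ?m\<close>]) blast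
  have "?m \<le> s" using btw mdist_nonneg[of X t "\<gamma> s"] by linarith
  then have "mdist X (\<gamma> s) (\<delta> ?m) = (s - u) + (?m - u)" using u s by simp
  then have "?m = u" using btw \<delta>(3) mdist_commute[of X t "\<gamma> s"] by simp
  then show ?thesis using u(4) \<delta>(3) by simp
qed

lemma real_tree_section:
  fixes X :: "'a metric" and T :: "'b metric" and \<pi> :: "'a \<Rightarrow> 'b"
  assumes T: "real_tree T" and geo: "geodesic_space X" and compl: "mcomplete_of X"
    and \<pi>: "\<And>x. x \<in> mspace X \<Longrightarrow> \<pi> x \<in> mspace T"
    and lip: "\<And>x y. x \<in> mspace X \<Longrightarrow> y \<in> mspace X \<Longrightarrow> mdist T (\<pi> x) (\<pi> y) \<le> mdist X x y"
    and lift: "\<And>x t. x \<in> mspace X \<Longrightarrow> t \<in> mspace T \<Longrightarrow>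
      \<exists>y\<in>mspace X. \<pi> y = t \<and> mdist X x y \<le> mdist T (\<pi> x) t"
    and x0: "x0 \<in> mspace X"
  obtains \<sigma> where "\<And>t. t \<in> mspace T \<Longrightarrow> \<sigma> t \<in> mspace X" "\<And>t. t \<in> mspace T \<Longrightarrow> \<pi> (\<sigma> t) = t"
    "\<And>s t. s \<in> mspace T \<Longrightarrow> t \<in> mspace T \<Longrightarrow> mdist X (\<sigma> s) (\<sigma> t) = mdist T s t"
proof -
  let ?o = "\<pi> x0"
  \<comment> \<open>A partial section is represented by its image in \<open>X\<close>: \<pi> is
    isometric, hence injective, on such a set, and the union of a chain of partial sections is
    simply the union of the sets. The third condition says that the projection of \<open>F\<close>
    is star-shaped about \<open>?o\<close>.\<close>
  define \<A> where "\<A> = {F. F \<subseteq> mspace X \<and> (\<forall>x\<in>F. \<forall>y\<in>F. mdist X x y = mdist T (\<pi> x) (\<pi> y)) \<and>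
    (\<forall>x\<in>F. \<forall>t\<in>mspace T. mdist T ?o t + mdist T t (\<pi> x) = mdist T ?o (\<pi> x) \<longrightarrow> t \<in> \<pi> ` F) \<and> x0 \<in> F}"
  have o: "?o \<in> mspace T" using \<pi> x0 by blast
  have "{x0} \<in> \<A>"
  proof -
    have self: "mdist T ?o ?o = 0" "mdist X x0 x0 = 0"
      using mdist_zero[OF o o] mdist_zero[OF x0 x0] by simp_all
    then have "t = ?o" if "t \<in> mspace T" "mdist T ?o t + mdist T t ?o = mdist T ?o ?o" for t
      using that mdist_zero[OF that(1) o] mdist_nonneg[of T ?o t] mdist_nonneg[of T t ?o] by simp
    then show ?thesis using x0 self by (auto simp: \<A>_def)
  qed
  moreover have "\<Union>\<C> \<in> \<A>" if "\<C> \<noteq> {}" "subset.chain \<A> \<C>" for \<C>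
  proof -
    have \<C>: "\<And>F. F \<in> \<C> \<Longrightarrow> F \<in> \<A>" "\<And>F F'. F \<in> \<C> \<Longrightarrow> F' \<in> \<C> \<Longrightarrow> F \<subseteq> F' \<or> F' \<subseteq> F"
      using that(2) by (auto simp: subset_chain_def)
    have "mdist X x y = mdist T (\<pi> x) (\<pi> y)" if xy: "x \<in> \<Union>\<C>" "y \<in> \<Union>\<C>" for x y
    proof -
      obtain F F' where FF': "F \<in> \<C>" "x \<in> F" "F' \<in> \<C>" "y \<in> F'" using xy by blast
      then obtain F where "F \<in> \<C>" "x \<in> F" "y \<in> F" using \<C>(2)[OF FF'(1,3)] by blast
      then show ?thesis using \<C>(1) unfolding \<A>_def by blast
    qed
    moreover have "t \<in> \<pi> ` \<Union>\<C>"
      if x: "x \<in> \<Union>\<C>" and t: "t \<in> mspace T" "mdist T ?o t + mdist T t (\<pi> x) = mdist T ?o (\<pi> x)" for x t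
    proof -
      obtain F where "F \<in> \<C>" "x \<in> F" using x by blast
      moreover then have "t \<in> \<pi> ` F" using t \<C>(1) unfolding \<A>_def by blast
      ultimately show ?thesis by blast
    qed
    moreover have "\<Union>\<C> \<subseteq> mspace X" "x0 \<in> \<Union>\<C>" using \<C>(1) \<open>\<C> \<noteq> {}\<close> unfolding \<A>_def by blast+
    ultimately show ?thesis unfolding \<A>_def by blast
  qed
  ultimately obtain F where F: "F \<in> \<A>" and max: "\<And>F'. F' \<in> \<A> \<Longrightarrow> F \<subseteq> F' \<Longrightarrow> F' = F"
    using subset_Zorn_nonempty[of \<A>] by blast
  have F_sub: "F \<subseteq> mspace X" and x0F: "x0 \<in> F"
    and F_iso: "\<And>x y. x \<in> F \<Longrightarrow> y \<in> F \<Longrightarrow> mdist X x y = mdist T (\<pi> x) (\<pi> y)"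
    and F_star: "\<And>x t. x \<in> F \<Longrightarrow> t \<in> mspace T \<Longrightarrow>
      mdist T ?o t + mdist T t (\<pi> x) = mdist T ?o (\<pi> x) \<Longrightarrow> t \<in> \<pi> ` F"
    using F unfolding \<A>_def by blast+
  \<comment> \<open>Let \<open>c\<close> be the time at which the geodesic from \<open>?o\<close> to \<open>p\<close> leaves \<open>\<pi> ` F\<close>. The lifts before \<open>c\<close>
    converge to a point \<open>y\<close>, and the rest of the geodesic is lifted from \<open>y\<close>.\<close>
  have onto: "p \<in> \<pi> ` F" if p: "p \<in> mspace T" for p
  proof -
    let ?l = "mdist T ?o p"
    obtain \<gamma> where \<gamma>: "geodesic_segment T \<gamma> ?l" "\<gamma> 0 = ?o" "\<gamma> ?l = p"
      using geodesic_space_segment[OF _ o p] T by (auto simp: real_tree_def)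
    note \<gamma>_in = geodesic_segment_in[OF \<gamma>(1)] and \<gamma>_dist = geodesic_segment_dist[OF \<gamma>(1)]
    define I where "I = {s. 0 \<le> s \<and> s \<le> ?l \<and> \<gamma> s \<in> \<pi> ` F}"
    define c where "c = Sup I"
    have I0: "0 \<in> I" using \<gamma>(2) x0F by (auto simp: I_def)
    have bdd: "bdd_above I" by (auto simp: I_def intro!: bdd_aboveI[of _ ?l])
    have I_le: "s \<le> c" if "s \<in> I" for s using cSup_upper[OF that bdd] by (simp add: c_def)
    have c: "0 \<le> c" "c \<le> ?l" using I_le[OF I0] I0 by (auto simp: c_def I_def intro!: cSup_least)
    \<comment> \<open>Star-shapedness makes the covered times an initial interval.\<close>
    have I_down: "r \<in> I" if "0 \<le> r" "r \<le> s" "s \<in> I" for r s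
    proof -
      obtain x where x: "x \<in> F" "\<gamma> s = \<pi> x" using \<open>s \<in> I\<close> by (auto simp: I_def)
      have s: "0 \<le> s" "s \<le> ?l" using \<open>s \<in> I\<close> by (auto simp: I_def)
      have "\<gamma> r \<in> \<pi> ` F"
        using that s x \<gamma>_dist[of 0 r] \<gamma>_dist[of r s] \<gamma>_dist[of 0 s] \<gamma>(2) \<gamma>_in[of r]
        by (intro F_star[OF x(1)]) auto
      then show ?thesis using that s by (simp add: I_def)
    qed
    have "\<exists>s\<in>I. c - 1 / (real n + 1) < s" for n
    proof -
      have "c - 1 / (real n + 1) < Sup I" by (simp add: c_def)
      then show ?thesis using less_cSup_iff[OF _ bdd] I0 by blast
    qed
    then obtain s where s: "\<And>n. s n \<in> I" "\<And>n. c - 1 / (real n + 1) < s n" by metis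
    then have "\<exists>x. x \<in> F \<and> \<pi> x = \<gamma> (s n)" for n
      using s(1)[of n] unfolding I_def by fastforce
    then obtain x where x: "\<And>n. x n \<in> F" "\<And>n. \<pi> (x n) = \<gamma> (s n)" by metis
    have xX: "x n \<in> mspace X" for n using x(1) F_sub by blast
    have s_le: "0 \<le> s n" "s n \<le> ?l" "s n \<le> c" for n
      using s(1)[of n] I_le by (auto simp: I_def)
    \<comment> \<open>The chosen lifts have the same mutual distances as their times, so they form a
      Cauchy sequence because the times converge to \<open>c\<close>.\<close>
    have x_dist: "mdist X (x m) (x n) = \<bar>s m - s n\<bar>" for m n
      using F_iso[OF x(1) x(1)] x(2) \<gamma>_dist s_le by simp
    interpret X: Metric_space "mspace X" "mdist X" by (rule Metric_space_mspace_mdist)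
    have inv: "(\<lambda>n. 1 / (real n + 1)) \<longlonglongrightarrow> 0"
      using LIMSEQ_inverse_real_of_nat by (simp add: inverse_eq_divide add.commute)
    have "X.MCauchy x"
      unfolding X.MCauchy_def
    proof (intro conjI allI impI)
      show "range x \<subseteq> mspace X" using xX by blast
      fix e :: real assume "e > 0"
      then obtain k where k: "\<And>n. n \<ge> k \<Longrightarrow> 1 / (real n + 1) < e"
        using order_tendstoD(2)[OF inv, of e] by (auto simp: eventually_sequentially)
      show "\<exists>N. \<forall>n n'. N \<le> n \<longrightarrow> N \<le> n' \<longrightarrow> mdist X (x n) (x n') < e"
      proof (intro exI[of _ k] allI impI)
        fix n n' assume "k \<le> n" "k \<le> n'"
        then show "mdist X (x n) (x n') < e"
          using k[of n] k[of n'] s(2)[of n] s(2)[of n'] s_le[of n] s_le[of n'] by (simp add: x_dist)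
      qed
    qed
    then obtain y where "limitin X.mtopology x y sequentially"
      using compl by (auto simp: mcomplete_of_def X.mcomplete_def)
    then have y: "y \<in> mspace X" and lim: "(\<lambda>n. mdist X (x n) y) \<longlonglongrightarrow> 0"
      by (auto simp: X.limitin_metric_dist_null)
    have s_lim: "s \<longlonglongrightarrow> c"
    proof (rule tendsto_sandwich[OF _ _ _ tendsto_const])
      show "(\<lambda>n. c - 1 / (real n + 1)) \<longlonglongrightarrow> c" using tendsto_diff[OF tendsto_const inv, of c] by simp
    qed (use s(2) s_le in \<open>auto intro!: always_eventually less_imp_le\<close>)
    \<comment> \<open>The isometry property of \<open>F\<close> passes to the limit point
      \<open>y\<close>, whether or not \<open>y\<close> belongs to \<open>F\<close>.\<close>
    have y_close: "mdist X z y \<le> mdist T (\<pi> z) (\<gamma> c)" if "z \<in> F" for z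
    proof (rule LIMSEQ_le_const)
      show "(\<lambda>n. mdist T (\<pi> z) (\<gamma> c) + \<bar>c - s n\<bar> + mdist X (x n) y) \<longlonglongrightarrow> mdist T (\<pi> z) (\<gamma> c)"
        using tendsto_add[OF tendsto_add[OF tendsto_const tendsto_rabs[OF tendsto_diff[OF tendsto_const s_lim]]] lim,
            of "mdist T (\<pi> z) (\<gamma> c)" c] by simp
      have "mdist X z y \<le> mdist T (\<pi> z) (\<gamma> c) + \<bar>c - s n\<bar> + mdist X (x n) y" for n
      proof -
        have zX: "z \<in> mspace X" using that F_sub by blast
        have "mdist X z y \<le> mdist X z (x n) + mdist X (x n) y"
          by (rule mdist_triangle[OF zX xX y])
        moreover have "mdist X z (x n) = mdist T (\<pi> z) (\<gamma> (s n))"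
          using F_iso[OF that x(1)] x(2) by simp
        moreover have "mdist T (\<pi> z) (\<gamma> (s n)) \<le> mdist T (\<pi> z) (\<gamma> c) + mdist T (\<gamma> c) (\<gamma> (s n))"
          using zX \<pi> c s_le \<gamma>_in by (intro mdist_triangle) auto
        ultimately show ?thesis using \<gamma>_dist[of c "s n"] c s_le by simp
      qed
      then show "\<exists>N. \<forall>n\<ge>N. mdist X z y \<le> mdist T (\<pi> z) (\<gamma> c) + \<bar>c - s n\<bar> + mdist X (x n) y"
        by blast
    qed
    have \<pi>y: "\<pi> y = \<gamma> c"
    proof -
      have "mdist T (\<pi> y) (\<gamma> c) \<le> 0"
      proof (rule LIMSEQ_le_const)
        show "(\<lambda>n. mdist X (x n) y + \<bar>s n - c\<bar>) \<longlonglongrightarrow> 0"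
          using tendsto_add[OF lim tendsto_rabs[OF tendsto_diff[OF s_lim tendsto_const]], of c] by simp
        have "mdist T (\<pi> y) (\<gamma> c) \<le> mdist X (x n) y + \<bar>s n - c\<bar>" for n
        proof -
          have "mdist T (\<pi> y) (\<gamma> c) \<le> mdist T (\<pi> y) (\<gamma> (s n)) + mdist T (\<gamma> (s n)) (\<gamma> c)"
            using y \<pi> c s_le \<gamma>_in by (intro mdist_triangle) auto
          then show ?thesis
            using lip[OF xX y, of n] x(2)[of n] \<gamma>_dist[of "s n" c] c s_le
              mdist_commute[of T "\<pi> y" "\<gamma> (s n)"] by simp
        qed
        then show "\<exists>N. \<forall>n\<ge>N. mdist T (\<pi> y) (\<gamma> c) \<le> mdist X (x n) y + \<bar>s n - c\<bar>" by blast
      qed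
      then show ?thesis using \<pi>[OF y] \<gamma>_in c by (metis mdist_nonneg mdist_zero order_antisym)
    qed
    have \<gamma>c_p: "mdist T (\<gamma> c) p = ?l - c" using \<gamma>_dist[of c ?l] \<gamma>(3) c by simp
    obtain z where z: "z \<in> mspace X" "\<pi> z = p" "mdist X y z \<le> ?l - c"
      using lift[OF y p] \<pi>y \<gamma>c_p by auto
    have yz: "mdist X y z = ?l - c" using lip[OF y z(1)] z \<pi>y \<gamma>c_p by simp
    obtain \<eta> where \<eta>: "geodesic_segment X \<eta> (?l - c)" "\<eta> 0 = y" "\<eta> (?l - c) = z"
      using geodesic_space_segment[OF geo y z(1)] yz by auto
    define \<theta> where "\<theta> r = \<eta> (r - c)" for r
    have \<theta>_in: "\<theta> r \<in> mspace X" if "c \<le> r" "r \<le> ?l" for r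
      using geodesic_segment_in[OF \<eta>(1)] that by (simp add: \<theta>_def)
    have \<theta>_dist: "mdist X (\<theta> r) (\<theta> q) = \<bar>r - q\<bar>" if "c \<le> r" "r \<le> ?l" "c \<le> q" "q \<le> ?l" for r q
      using geodesic_segment_dist[OF \<eta>(1)] that by (simp add: \<theta>_def)
    have \<theta>: "\<theta> c = y" "\<theta> ?l = z" using \<eta> by (auto simp: \<theta>_def)
    \<comment> \<open>The projection cannot lengthen the two halves of the lifted geodesic, yet
      together with the initial part of length \<open>c\<close> they must cover the distance
      \<open>?l\<close>. Hence every inequality is an equality, and the projected point lies between
      \<open>?o\<close> and \<open>p\<close>.\<close>
    have \<pi>\<theta>: "\<pi> (\<theta> r) = \<gamma> r" if r: "c \<le> r" "r \<le> ?l" for r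
    proof -
      let ?t = "\<pi> (\<theta> r)"
      have tT: "?t \<in> mspace T" using \<pi> \<theta>_in r by blast
      have 1: "mdist T (\<gamma> c) ?t \<le> r - c"
        using lip[OF y \<theta>_in[OF r]] \<theta>_dist[of c r] \<theta>(1) \<pi>y r c by simp
      have 2: "mdist T ?t p \<le> ?l - r"
        using lip[OF \<theta>_in[OF r] z(1)] \<theta>_dist[of r ?l] \<theta>(2) z(2) r c by simp
      have 3: "mdist T ?o ?t \<le> mdist T ?o (\<gamma> c) + mdist T (\<gamma> c) ?t"
        using o tT \<gamma>_in c by (intro mdist_triangle) auto
      have 4: "?l \<le> mdist T ?o ?t + mdist T ?t p" by (rule mdist_triangle[OF o tT p])
      have 5: "mdist T ?o (\<gamma> c) = c" using \<gamma>_dist[of 0 c] \<gamma>(2) c by simp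
      have "mdist T ?o ?t = r" "mdist T ?t p = ?l - r" using 1 2 3 4 5 by linarith+
      then show ?thesis
        using real_tree_between[OF T \<gamma>(1), of ?l ?t] tT \<gamma>(2,3) by simp
    qed
    \<comment> \<open>The branch point of \<gamma> and the geodesic to \<open>\<pi> w\<close> lies
      on the latter, hence over \<open>F\<close> by star-shapedness. Branching therefore happens no
      later than \<open>c\<close>, and after \<open>c\<close> the distance to \<open>\<pi> w\<close>
      grows at unit speed.\<close>
    have far: "mdist T (\<pi> w) (\<gamma> r) = mdist T (\<pi> w) (\<gamma> c) + (r - c)"
      if w: "w \<in> F" and r: "c \<le> r" "r \<le> ?l" for w r
    proof -
      have wT: "\<pi> w \<in> mspace T" using w F_sub \<pi> by blast
      let ?m = "mdist T ?o (\<pi> w)"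
      obtain \<delta> where \<delta>: "geodesic_segment T \<delta> ?m" "\<delta> 0 = ?o" "\<delta> ?m = \<pi> w"
        using geodesic_space_segment[OF _ o wT] T by (auto simp: real_tree_def)
      have start: "\<gamma> 0 = \<delta> 0" using \<gamma>(2) \<delta>(2) by simp
      obtain u where u: "0 \<le> u" "u \<le> ?l" "u \<le> ?m" "\<gamma> u = \<delta> u"
        "\<And>s t. u \<le> s \<Longrightarrow> s \<le> ?l \<Longrightarrow> u \<le> t \<Longrightarrow> t \<le> ?m \<Longrightarrow> mdist T (\<gamma> s) (\<delta> t) = (s - u) + (t - u)"
        by (rule real_tree_branch[OF T \<gamma>(1) \<delta>(1) start]) auto
      have "\<gamma> u \<in> \<pi> ` F"
        using geodesic_segment_dist[OF \<delta>(1), of 0 u] geodesic_segment_dist[OF \<delta>(1), of u ?m]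
          geodesic_segment_dist[OF \<delta>(1), of 0 ?m] geodesic_segment_in[OF \<delta>(1), of u] u \<delta>(2,3)
        by (intro F_star[OF w]) auto
      then have "u \<le> c" using I_le u by (simp add: I_def)
      then show ?thesis
        using u(5)[of r ?m] u(5)[of c ?m] u(1,2,3) r c \<delta>(3)
          mdist_commute[of T "\<pi> w"] by simp
    qed
    \<comment> \<open>The closed interval also adjoins the limit point \<open>y\<close>, so it does
      not matter whether the supremum \<open>c\<close> is attained.\<close>
    let ?F = "F \<union> \<theta> ` {c..?l}"
    \<comment> \<open>Upstairs the route through \<open>y\<close> gives the upper bound; by
      \<open>far\<close> it is exactly the distance in the tree, which is the lower bound.\<close>
    have cross: "mdist X w (\<theta> r) = mdist T (\<pi> w) (\<pi> (\<theta> r))"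
      if w: "w \<in> F" and r: "c \<le> r" "r \<le> ?l" for w r
    proof (rule antisym)
      have wX: "w \<in> mspace X" using w F_sub by blast
      have "mdist X w (\<theta> r) \<le> mdist X w y + mdist X y (\<theta> r)"
        by (rule mdist_triangle[OF wX y \<theta>_in[OF r]])
      also have "\<dots> \<le> mdist T (\<pi> w) (\<gamma> c) + (r - c)"
        using y_close[OF w] \<theta>_dist[of c r] \<theta>(1) r c by simp
      finally show "mdist X w (\<theta> r) \<le> mdist T (\<pi> w) (\<pi> (\<theta> r))"
        using far[OF w r] \<pi>\<theta>[OF r] by simp
      show "mdist T (\<pi> w) (\<pi> (\<theta> r)) \<le> mdist X w (\<theta> r)" by (rule lip[OF wX \<theta>_in[OF r]])
    qed
    have "?F \<in> \<A>"
      unfolding \<A>_def mem_Collect_eq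
    proof (intro conjI ballI impI)
      show "?F \<subseteq> mspace X" using F_sub \<theta>_in by auto
      show "x0 \<in> ?F" using x0F by blast
      fix v w assume vw: "v \<in> ?F" "w \<in> ?F"
      show "mdist X v w = mdist T (\<pi> v) (\<pi> w)"
      proof -
        consider "v \<in> F" "w \<in> F" | r where "v \<in> F" "c \<le> r" "r \<le> ?l" "w = \<theta> r"
          | r where "w \<in> F" "c \<le> r" "r \<le> ?l" "v = \<theta> r"
          | r q where "c \<le> r" "r \<le> ?l" "v = \<theta> r" "c \<le> q" "q \<le> ?l" "w = \<theta> q"
          using vw by auto
        then show ?thesis
        proof cases
          case 1
          then show ?thesis by (rule F_iso)
        next
          case 2
          then show ?thesis using cross by simp
        next
          case 3
          then show ?thesis using cross by (metis mdist_commute)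
        next
          case 4
          then show ?thesis using \<theta>_dist[of r q] \<pi>\<theta> \<gamma>_dist[of r q] c by simp
        qed
      qed
    next
      fix v t assume v: "v \<in> ?F" and t: "t \<in> mspace T"
        and btw: "mdist T ?o t + mdist T t (\<pi> v) = mdist T ?o (\<pi> v)"
      show "t \<in> \<pi> ` ?F"
      proof (cases "v \<in> F")
        case True
        then show ?thesis using F_star[OF _ t btw] by blast
      next
        case False
        then obtain r where r: "c \<le> r" "r \<le> ?l" "v = \<theta> r" using v by auto
        have "mdist T ?o (\<pi> v) = r" using \<gamma>_dist[of 0 r] \<gamma>(2) \<pi>\<theta> r c by simp
        then have btw': "mdist T ?o t + mdist T t (\<gamma> r) = r" using btw r \<pi>\<theta> by simp
        then have eq: "t = \<gamma> (mdist T ?o t)"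
          using real_tree_between[OF T \<gamma>(1), of r t] t r c \<gamma>(2) by simp
        have le: "mdist T ?o t \<le> r" using btw' mdist_nonneg[of T t "\<gamma> r"] by linarith
        \<comment> \<open>Times before \<open>c\<close> are covered by \<open>F\<close>, times from
          \<open>c\<close> on by the lifted geodesic.\<close>
        show ?thesis
        proof (cases "mdist T ?o t < c")
          case True
          then obtain q where "q \<in> I" "mdist T ?o t < q"
            using less_cSup_iff[OF _ bdd] I0 unfolding c_def by blast
          then have "mdist T ?o t \<in> I" using I_down[of _ q] by (simp add: less_imp_le)
          then show ?thesis using eq by (auto simp: I_def)
        next
          case False
          then have "t = \<pi> (\<theta> (mdist T ?o t))" using \<pi>\<theta> le r eq by simp
          then show ?thesis using False le r by (intro image_eqI[of _ _ "\<theta> (mdist T ?o t)"]) auto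
        qed
      qed
    qed
    then have "?F = F" by (rule max) blast
    then have "z \<in> F" using \<theta>(2) c by force
    then show ?thesis using z(2) by blast
  qed
  define \<sigma> where "\<sigma> t = (SOME x. x \<in> F \<and> \<pi> x = t)" for t
  have \<sigma>: "\<sigma> t \<in> F \<and> \<pi> (\<sigma> t) = t" if "t \<in> mspace T" for t
    unfolding \<sigma>_def by (rule someI_ex) (use onto[OF that] in blast)
  show ?thesis
    by (rule that[of \<sigma>]) (use \<sigma> F_sub F_iso in auto)
qed

subsection \<open>Completeness and geodesics of asymptotic cones\<close>

text \<open>An ultrafilter that concentrates on one point \<open>a\<close> is
  \<open>principal {a}\<close>. Otherwise each point is avoided eventually, and so is each finite
  initial segment.\<close>

lemma nonprincipal_ultrafilter_le_sequentially:
  assumes "nonprincipal_ultrafilter \<omega>"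
  shows "\<omega> \<le> sequentially"
proof -
  have ultra: "\<omega> \<noteq> bot" "\<And>P. eventually P \<omega> \<or> eventually (\<lambda>x. \<not> P x) \<omega>"
    and np: "\<And>a. \<omega> \<noteq> principal {a}"
    using assms by (auto simp: nonprincipal_ultrafilter_def ultrafilter_def)
  have neq: "eventually (\<lambda>n. n \<noteq> a) \<omega>" for a
  proof (rule ccontr)
    assume "\<not> eventually (\<lambda>n. n \<noteq> a) \<omega>"
    then have a: "eventually (\<lambda>n. n = a) \<omega>" using ultra(2)[of "\<lambda>n. n = a"] by blast
    have "eventually P \<omega> \<longleftrightarrow> eventually P (principal {a})" for P
    proof
      assume "eventually P \<omega>"
      then have "eventually (\<lambda>n. P n \<and> n = a) \<omega>" using a by (rule eventually_conj)
      then have "\<exists>n. P n \<and> n = a" using ultra(1) eventually_happens' by fastforce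
      then show "eventually P (principal {a})" by (simp add: eventually_principal)
    next
      assume "eventually P (principal {a})"
      then have "P a" by (simp add: eventually_principal)
      then show "eventually P \<omega>" by (intro eventually_mono[OF a]) simp
    qed
    then show False using np[of a] by (simp add: filter_eq_iff)
  qed
  have "eventually (\<lambda>n. n \<ge> k) \<omega>" for k
  proof -
    have "eventually (\<lambda>n. \<forall>a\<in>{..<k}. n \<noteq> a) \<omega>" using neq by (intro eventually_ball_finite) auto
    then show ?thesis by (rule eventually_mono) (auto simp: not_le[symmetric])
  qed
  then show ?thesis
    by (intro filter_leI) (metis (mono_tags, lifting) eventually_mono eventually_sequentially)
qed

lemma scaling_sequence_filterlim:
  assumes "scaling_sequence d"
  shows "filterlim d at_top sequentially"
  unfolding filterlim_at_top
proof
  fix Z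
  obtain N where N: "Z < d N"
    using assms unfolding scaling_sequence_def bdd_above_def by (auto simp: not_le)
  have "Z \<le> d n" if "N \<le> n" for n
    using N incseqD[of d N n] assms that by (simp add: scaling_sequence_def)
  then show "\<forall>\<^sub>F n in sequentially. Z \<le> d n" by (auto simp: eventually_sequentially)
qed

locale cone =
  fixes X :: "'a metric" and x0 :: 'a and \<omega> :: "nat filter" and d :: "nat \<Rightarrow> real"
  assumes np: "nonprincipal_ultrafilter \<omega>" and scaling: "scaling_sequence d"
    and base: "x0 \<in> mspace X"
begin

abbreviation "Con \<equiv> asymptotic_cone \<omega> X x0 d"
abbreviation "seqs \<equiv> cone_seqs X x0 d"

definition cls :: "(nat \<Rightarrow> 'a) \<Rightarrow> (nat \<Rightarrow> 'a) set" where
  "cls x = cone_rel \<omega> X x0 d `` {x}"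

lemma ultra: "ultrafilter \<omega>" and d_pos: "0 < d n" and not_bot: "\<omega> \<noteq> bot"
  using np scaling by (auto simp: nonprincipal_ultrafilter_def scaling_sequence_def ultrafilter_def)

lemma eventually_ge: "eventually (\<lambda>n. n \<ge> k) \<omega>"
  using nonprincipal_ultrafilter_le_sequentially[OF np] eventually_ge_at_top[of k]
  by (simp add: le_filter_def)

text \<open>This makes bounded additive errors, such as those from rounding times to integers,
  vanish in the cone.\<close>

lemma inverse_scale_tendsto: "((\<lambda>n. c / d n) \<longlongrightarrow> 0) \<omega>"
proof -
  have "((\<lambda>n. c / d n) \<longlongrightarrow> 0) sequentially"
    by (rule tendsto_divide_0[OF tendsto_const
          filterlim_at_top_imp_at_infinity[OF scaling_sequence_filterlim[OF scaling]]])
  then show ?thesis by (rule filterlim_mono) (use nonprincipal_ultrafilter_le_sequentially[OF np] in auto)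
qed

lemma seqs_in: "x \<in> seqs \<Longrightarrow> x n \<in> mspace X"
  by (simp add: cone_seqs_def)

lemma base_seqs: "(\<lambda>_. x0) \<in> seqs"
proof -
  have self: "mdist X x0 x0 = 0" using base by simp
  show ?thesis using base by (auto simp: cone_seqs_def self)
qed

text \<open>The estimate is required at every index, because \<open>cone_seqs\<close> asks for a
  bound at all indices and not only \<omega>-almost everywhere.\<close>

lemma seqs_near:
  assumes y: "y \<in> seqs" and x: "\<And>n. x n \<in> mspace X" and near: "\<And>n. mdist X (y n) (x n) \<le> B * d n"
  shows "x \<in> seqs"
proof -
  obtain C where C: "\<And>n. mdist X x0 (y n) / d n \<le> C" using y by (auto simp: cone_seqs_def)
  have "mdist X x0 (x n) / d n \<le> C + B" for n
  proof -
    have "mdist X x0 (x n) \<le> mdist X x0 (y n) + mdist X (y n) (x n)"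
      by (rule mdist_triangle[OF base seqs_in[OF y] x])
    also have "\<dots> \<le> C * d n + B * d n"
      using C[of n] near[of n] d_pos[of n] by (simp add: pos_divide_le_eq)
    finally show ?thesis using d_pos[of n] by (simp add: pos_divide_le_eq distrib_right)
  qed
  then show ?thesis using x by (auto simp: cone_seqs_def)
qed

lemma seqs_bound:
  assumes x: "x \<in> seqs" and y: "y \<in> seqs"
  obtains B where "\<And>n. mdist X (x n) (y n) / d n \<le> B"
proof -
  obtain B C where B: "\<And>n. mdist X x0 (x n) / d n \<le> B" and C: "\<And>n. mdist X x0 (y n) / d n \<le> C"
    using x y by (auto simp: cone_seqs_def)
  have "mdist X (x n) (y n) / d n \<le> B + C" for n
  proof -
    have "mdist X (x n) (y n) \<le> mdist X x0 (x n) + mdist X x0 (y n)"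
      using mdist_triangle[OF seqs_in[OF x, of n] base seqs_in[OF y, of n]] mdist_commute[of X x0 "x n"] by simp
    also have "\<dots> \<le> B * d n + C * d n"
      using B[of n] C[of n] d_pos[of n] by (simp add: pos_divide_le_eq)
    finally show ?thesis using d_pos[of n] by (simp add: pos_divide_le_eq distrib_right)
  qed
  then show ?thesis by (rule that)
qed

lemma mspace_Con: "mspace Con = cone_points \<omega> X x0 d"
  by (rule mspace_asymptotic_cone[OF ultra d_pos base])

lemma cls_in: "x \<in> seqs \<Longrightarrow> cls x \<in> mspace Con"
  unfolding mspace_Con cone_points_def cls_def by (rule quotientI)

lemma cls_rep:
  assumes "U \<in> mspace Con"
  shows "\<exists>x\<in>seqs. U = cls x"
  using assms unfolding mspace_Con cone_points_def cls_def by (rule quotientE) blast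

lemma cls_dist:
  assumes x: "x \<in> seqs" and y: "y \<in> seqs"
  shows "((\<lambda>n. mdist X (x n) (y n) / d n) \<longlongrightarrow> mdist Con (cls x) (cls y)) \<omega>"
proof -
  obtain B where "\<And>n. mdist X (x n) (y n) / d n \<le> B" using seqs_bound[OF x y] by blast
  then have "\<And>n. \<bar>mdist X (x n) (y n) / d n\<bar> \<le> B"
    using d_pos by (simp add: less_imp_le)
  then obtain r where r: "((\<lambda>n. mdist X (x n) (y n) / d n) \<longlongrightarrow> r) \<omega>"
    using ultrafilter_bounded_limit[OF ultra, of "\<lambda>n. mdist X (x n) (y n) / d n" B] by blast
  have "mdist Con (cls x) (cls y) = r"
    using cone_dist_eq[OF ultra d_pos base x y r] mdist_asymptotic_cone[OF ultra d_pos base]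
    by (simp add: cls_def)
  then show ?thesis using r by simp
qed

lemma cls_dist_eqI:
  "x \<in> seqs \<Longrightarrow> y \<in> seqs \<Longrightarrow> ((\<lambda>n. mdist X (x n) (y n) / d n) \<longlongrightarrow> r) \<omega> \<Longrightarrow>
    mdist Con (cls x) (cls y) = r"
  using cls_dist not_bot tendsto_unique by blast

lemma cls_dist_le:
  assumes "x \<in> seqs" "y \<in> seqs" "(f \<longlongrightarrow> r) \<omega>"
    and "eventually (\<lambda>n. mdist X (x n) (y n) / d n \<le> f n) \<omega>"
  shows "mdist Con (cls x) (cls y) \<le> r"
  by (rule tendsto_le[OF not_bot assms(3) cls_dist[OF assms(1,2)] assms(4)])

lemma cls_eq_iff:
  assumes "x \<in> seqs" "y \<in> seqs"
  shows "cls x = cls y \<longleftrightarrow> ((\<lambda>n. mdist X (x n) (y n) / d n) \<longlongrightarrow> 0) \<omega>"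
  using cls_dist[OF assms] cls_dist_eqI[OF assms, of 0] mdist_zero[OF cls_in cls_in, OF assms] by auto

text \<open>A diagonal argument: each finite set of limit relations holds approximately at
  \<omega>-almost every index, so one sequence can satisfy more and more of them.\<close>

lemma mcomplete_of_Con: "mcomplete_of Con"
proof -
  interpret C: Metric_space "mspace Con" "mdist Con" by (rule Metric_space_mspace_mdist)
  have "\<exists>V. limitin C.mtopology U V sequentially" if U: "C.MCauchy U" for U
  proof -
    have UC: "U k \<in> mspace Con" for k using U by (auto simp: C.MCauchy_def)
    then have "\<forall>k. \<exists>x. x \<in> seqs \<and> U k = cls x" using cls_rep by blast
    then obtain x where x: "\<And>k. x k \<in> seqs" "\<And>k. U k = cls (x k)" by metis
    \<comment> \<open>The limit follows the \<open>k n\<close>-th sequence at index \<open>n\<close>, where \<open>k n\<close> is the largest number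
      up to which all distances at scale \<open>d n\<close> are already close to their limits.\<close>
    define P where "P k n \<longleftrightarrow> (\<forall>i\<le>k. \<forall>j\<le>k. mdist X (x i n) (x j n) / d n
        \<le> mdist Con (U i) (U j) + 1 / (real k + 1))" for k n
    \<comment> \<open>At stage 0 the condition holds at every index, so \<open>k n\<close> is always
      the maximum of a nonempty set.\<close>
    have P0: "P 0 n" for n
      using mdist_zero[OF seqs_in[OF x(1)] seqs_in[OF x(1)], of 0 n 0 n] by (simp add: P_def)
    have P_ev: "eventually (P k) \<omega>" for k
    proof -
      have "eventually (\<lambda>n. \<forall>i\<in>{..k}. \<forall>j\<in>{..k}. mdist X (x i n) (x j n) / d n
          < mdist Con (U i) (U j) + 1 / (real k + 1)) \<omega>"
      proof (intro eventually_ball_finite ballI finite_atMost)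
        fix i j
        show "eventually (\<lambda>n. mdist X (x i n) (x j n) / d n
            < mdist Con (U i) (U j) + 1 / (real k + 1)) \<omega>"
          using cls_dist[OF x(1) x(1), of i j] by (intro order_tendstoD(2)) (auto simp: x(2))
      qed
      then show ?thesis by (rule eventually_mono) (auto simp: P_def less_imp_le)
    qed
    \<comment> \<open>The cap \<open>k \<le> n\<close> keeps the set finite. It is harmless in the
      limit, since every fixed \<open>j\<close> is below \<omega>-almost all indices.\<close>
    define k where "k n = Max {k. k \<le> n \<and> P k n}" for n
    have fin: "finite {k. k \<le> n \<and> P k n}" for n by simp
    have k_P: "P (k n) n" for n
      using Max_in[OF fin[of n]] P0 unfolding k_def by blast
    have k_ge: "j \<le> k n" if "j \<le> n" "P j n" for j n
      using Max_ge[OF fin[of n], of j] that by (simp add: k_def)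
    define z where "z n = x (k n) n" for n
    have z_close: "mdist X (x j n) (z n) / d n \<le> mdist Con (U j) (U (k n)) + 1 / (real (k n) + 1)"
      if "j \<le> k n" for j n
      using k_P[of n] that by (simp add: P_def z_def)
    obtain N where N: "\<And>n n'. N \<le> n \<Longrightarrow> N \<le> n' \<Longrightarrow> mdist Con (U n) (U n') < 1"
      using U unfolding C.MCauchy_def by (meson zero_less_one)
    \<comment> \<open>A bound for the whole Cauchy sequence: finitely many distances up to
      \<open>N\<close>, and 1 for the tail. In \<open>M + 1\<close> below, the further 1 is the
      largest tolerance, the one at \<open>k n = 0\<close>.\<close>
    define M where "M = Max ((\<lambda>i. mdist Con (U 0) (U i)) ` {..N}) + 1"
    have M: "mdist Con (U 0) (U i) \<le> M" for i
    proof (cases "i \<le> N")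
      case True
      then have "mdist Con (U 0) (U i) \<le> Max ((\<lambda>i. mdist Con (U 0) (U i)) ` {..N})"
        by (intro Max_ge) auto
      then show ?thesis by (simp add: M_def)
    next
      case False
      have "mdist Con (U 0) (U N) \<le> Max ((\<lambda>i. mdist Con (U 0) (U i)) ` {..N})"
        by (intro Max_ge) auto
      moreover have "mdist Con (U 0) (U i) \<le> mdist Con (U 0) (U N) + mdist Con (U N) (U i)"
        by (intro mdist_triangle UC)
      ultimately show ?thesis using N[of N i] False unfolding M_def by linarith
    qed
    have z: "z \<in> seqs"
    proof (rule seqs_near[OF x(1)[of 0], of z "M + 1"])
      show "z n \<in> mspace X" for n using seqs_in[OF x(1)] by (simp add: z_def)
      fix n
      have "1 / (real (k n) + 1) \<le> 1" by simp
      then have "mdist X (x 0 n) (z n) / d n \<le> M + 1"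
        using z_close[of 0 n] M[of "k n"] by linarith
      then show "mdist X (x 0 n) (z n) \<le> (M + 1) * d n"
        using d_pos[of n] by (simp add: pos_divide_le_eq)
    qed
    have "limitin C.mtopology U (cls z) sequentially"
      unfolding C.limitin_metric
    proof (intro conjI allI impI)
      show "cls z \<in> mspace Con" by (rule cls_in[OF z])
      fix e :: real assume "e > 0"
      then obtain N where N: "\<And>n n'. N \<le> n \<Longrightarrow> N \<le> n' \<Longrightarrow> mdist Con (U n) (U n') < e / 3"
        using U unfolding C.MCauchy_def by (meson divide_pos_pos zero_less_numeral)
      obtain N' where N': "\<And>n. N' \<le> n \<Longrightarrow> 1 / (real n + 1) < e / 3"
        using order_tendstoD(2)[OF LIMSEQ_inverse_real_of_nat, of "e / 3"] \<open>e > 0\<close>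
        by (auto simp: eventually_sequentially inverse_eq_divide add.commute)
      \<comment> \<open>As \<open>k n \<ge> j\<close>, one third of \<open>e\<close> covers the
        Cauchy distance to \<open>U (k n)\<close> and one third the tolerance; the last third makes
        the inequality strict.\<close>
      have "mdist Con (U j) (cls z) < e" if j: "N \<le> j" "N' \<le> j" for j
      proof -
        have "eventually (\<lambda>n. P j n \<and> j \<le> n) \<omega>" using P_ev eventually_ge by (rule eventually_conj)
        then have "eventually (\<lambda>n. mdist X (x j n) (z n) / d n \<le> 2 * e / 3) \<omega>"
        proof (rule eventually_mono)
          fix n assume n: "P j n \<and> j \<le> n"
          then have "j \<le> k n" using k_ge by blast
          then show "mdist X (x j n) (z n) / d n \<le> 2 * e / 3"
            using z_close[of j n] N[of j "k n"] N'[of "k n"] j \<open>e > 0\<close> by linarith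
        qed
        then have "mdist Con (U j) (cls z) \<le> 2 * e / 3"
          unfolding x(2) by (rule cls_dist_le[OF x(1) z tendsto_const])
        then show ?thesis using \<open>e > 0\<close> by simp
      qed
      then show "\<forall>\<^sub>F n in sequentially. U n \<in> mspace Con \<and> mdist Con (U n) (cls z) < e"
        using UC by (auto simp: eventually_sequentially intro!: exI[of _ "max N N'"])
    qed
    then show ?thesis by blast
  qed
  then show ?thesis by (simp add: mcomplete_of_def C.mcomplete_def)
qed

text \<open>Discrete paths, run at speed \<open>d n\<close> with rounded times, become a 1-Lipschitz
  path in the cone. It joins two points in time equal to their distance, so it can lose no length
  anywhere and is a geodesic.\<close>

lemma geodesic_space_Con:
  assumes path: "\<And>x y. x \<in> mspace X \<Longrightarrow> y \<in> mspace X \<Longrightarrow>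
    \<exists>f :: nat \<Rightarrow> 'a. f 0 = x \<and> range f \<subseteq> mspace X \<and>
      (\<forall>i j. mdist X (f i) (f j) \<le> \<bar>real i - real j\<bar>) \<and> (\<forall>i. mdist X x y \<le> real i \<longrightarrow> f i = y)"
  shows "geodesic_space Con"
  unfolding geodesic_space_def
proof (intro ballI)
  fix U V assume U: "U \<in> mspace Con" and V: "V \<in> mspace Con"
  obtain x y where x: "x \<in> seqs" "U = cls x" and y: "y \<in> seqs" "V = cls y"
    using cls_rep[OF U] cls_rep[OF V] by blast
  have "\<forall>n. \<exists>f :: nat \<Rightarrow> 'a. f 0 = x n \<and> range f \<subseteq> mspace X \<and>
      (\<forall>i j. mdist X (f i) (f j) \<le> \<bar>real i - real j\<bar>) \<and> (\<forall>i. mdist X (x n) (y n) \<le> real i \<longrightarrow> f i = y n)"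
    using path seqs_in x y by blast
  then obtain f where f: "\<And>n. f n 0 = x n" "\<And>n. range (f n) \<subseteq> mspace X"
    "\<And>n i j. mdist X (f n i) (f n j) \<le> \<bar>real i - real j\<bar>"
    "\<And>n i. mdist X (x n) (y n) \<le> real i \<Longrightarrow> f n i = y n"
    by metis
  let ?L = "mdist Con U V"
  define \<zeta> where "\<zeta> s n = f n (nat \<lfloor>s * d n\<rfloor>)" for s n
  have floor: "\<bar>real (nat \<lfloor>s * d n\<rfloor>) - s * d n\<bar> \<le> 1" "real (nat \<lfloor>s * d n\<rfloor>) \<le> s * d n" if "0 \<le> s" for s n
    using that d_pos[of n] by (auto simp: abs_le_iff) linarith+
  have \<zeta>: "\<zeta> s \<in> seqs" if "0 \<le> s" for s
  proof (rule seqs_near[OF x(1)])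
    show "\<zeta> s n \<in> mspace X" for n using f(2) by (auto simp: \<zeta>_def)
    show "mdist X (x n) (\<zeta> s n) \<le> s * d n" for n
      using f(3)[of n 0 "nat \<lfloor>s * d n\<rfloor>"] f(1) floor(2)[OF that, of n] by (simp add: \<zeta>_def)
  qed
  have \<zeta>0: "cls (\<zeta> 0) = U" using f(1) x(2) by (simp add: \<zeta>_def[abs_def])
  have lip: "mdist Con (cls (\<zeta> s)) (cls (\<zeta> t)) \<le> \<bar>s - t\<bar>" if st: "0 \<le> s" "0 \<le> t" for s t
  proof (rule cls_dist_le[OF \<zeta> \<zeta>, OF st])
    \<comment> \<open>The 2 consists of one rounding error for each of the two times.\<close>
    show "((\<lambda>n. \<bar>s - t\<bar> + 2 / d n) \<longlongrightarrow> \<bar>s - t\<bar>) \<omega>"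
      using tendsto_add[OF tendsto_const inverse_scale_tendsto, of "\<bar>s - t\<bar>" 2] by simp
    have "mdist X (\<zeta> s n) (\<zeta> t n) / d n \<le> \<bar>s - t\<bar> + 2 / d n" for n
    proof -
      have "mdist X (\<zeta> s n) (\<zeta> t n) \<le> \<bar>s * d n - t * d n\<bar> + 2"
        using f(3)[of n "nat \<lfloor>s * d n\<rfloor>" "nat \<lfloor>t * d n\<rfloor>"] floor(1)[OF st(1), of n] floor(1)[OF st(2), of n]
        unfolding \<zeta>_def by linarith
      also have "\<dots> = \<bar>s - t\<bar> * d n + 2"
        using d_pos[of n] by (simp add: abs_mult flip: left_diff_distrib)
      finally show ?thesis using d_pos[of n] by (simp add: field_simps)
    qed
    then show "eventually (\<lambda>n. mdist X (\<zeta> s n) (\<zeta> t n) / d n \<le> \<bar>s - t\<bar> + 2 / d n) \<omega>" by simp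
  qed
  have L0: "0 \<le> ?L" by simp
  have \<zeta>L: "cls (\<zeta> ?L) = V"
  proof -
    have "mdist Con (cls (\<zeta> ?L)) (cls y) \<le> 0"
    proof (rule cls_dist_le[OF \<zeta>[OF L0] y(1)])
      show "((\<lambda>n. \<bar>?L - mdist X (x n) (y n) / d n\<bar> + 2 / d n) \<longlongrightarrow> 0) \<omega>"
        using tendsto_add[OF tendsto_rabs[OF tendsto_diff[OF tendsto_const cls_dist[OF x(1) y(1)]]]
            inverse_scale_tendsto, of ?L 2] x(2) y(2) by simp
      have "mdist X (\<zeta> ?L n) (y n) / d n \<le> \<bar>?L - mdist X (x n) (y n) / d n\<bar> + 2 / d n" for n
      proof -
        \<comment> \<open>An integer time at which the discrete path has already arrived at
          \<open>y n\<close>; rounding up costs at most 1, as does the floor in \<zeta>.\<close>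
        let ?c = "nat \<lceil>mdist X (x n) (y n)\<rceil>"
        have c: "mdist X (x n) (y n) \<le> real ?c" "real ?c \<le> mdist X (x n) (y n) + 1"
          using mdist_nonneg[of X "x n" "y n"] by linarith+
        have "mdist X (\<zeta> ?L n) (y n) \<le> \<bar>real (nat \<lfloor>?L * d n\<rfloor>) - real ?c\<bar>"
          using f(3)[of n "nat \<lfloor>?L * d n\<rfloor>" ?c] f(4)[OF c(1)] by (simp add: \<zeta>_def)
        also have "\<dots> \<le> \<bar>?L * d n - mdist X (x n) (y n)\<bar> + 2"
          using c floor(1)[OF L0, of n] by linarith
        also have "\<dots> = \<bar>?L - mdist X (x n) (y n) / d n\<bar> * d n + 2"
        proof -
          have "?L * d n - mdist X (x n) (y n) = (?L - mdist X (x n) (y n) / d n) * d n"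
            using d_pos[of n] by (simp add: field_simps)
          then show ?thesis using d_pos[of n] by (simp add: abs_mult)
        qed
        finally show ?thesis using d_pos[of n] by (simp add: pos_divide_le_eq distrib_right)
      qed
      then show "eventually (\<lambda>n. mdist X (\<zeta> ?L n) (y n) / d n
          \<le> \<bar>?L - mdist X (x n) (y n) / d n\<bar> + 2 / d n) \<omega>" by simp
    qed
    then show ?thesis
      using mdist_zero[OF cls_in[OF \<zeta>[OF L0]] V] mdist_nonneg[of Con "cls (\<zeta> ?L)" V] y(2)
      by (metis order_antisym)
  qed
  have iso: "mdist Con (cls (\<zeta> s)) (cls (\<zeta> t)) = t - s" if st: "0 \<le> s" "s \<le> t" "t \<le> ?L" for s t
  proof -
    have C: "cls (\<zeta> s) \<in> mspace Con" "cls (\<zeta> t) \<in> mspace Con" using \<zeta> cls_in st by auto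
    have "?L \<le> mdist Con U (cls (\<zeta> s)) + mdist Con (cls (\<zeta> s)) V" by (rule mdist_triangle[OF U C(1) V])
    moreover have "mdist Con (cls (\<zeta> s)) V \<le> mdist Con (cls (\<zeta> s)) (cls (\<zeta> t)) + mdist Con (cls (\<zeta> t)) V"
      by (rule mdist_triangle[OF C V])
    ultimately show ?thesis
      using lip[of 0 s] lip[of t ?L] lip[of s t] st \<zeta>0 \<zeta>L by simp
  qed
  show "\<exists>\<gamma> :: real \<Rightarrow> _. \<gamma> 0 = U \<and> \<gamma> ?L = V \<and> (\<forall>s\<in>{0..?L}. \<gamma> s \<in> mspace Con) \<and>
      (\<forall>s\<in>{0..?L}. \<forall>t\<in>{0..?L}. mdist Con (\<gamma> s) (\<gamma> t) = \<bar>s - t\<bar>)"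
  proof (intro exI[of _ "\<lambda>s. cls (\<zeta> s)"] conjI ballI \<zeta>0 \<zeta>L)
    show "cls (\<zeta> s) \<in> mspace Con" if "s \<in> {0..?L}" for s using \<zeta> cls_in that by simp
    show "mdist Con (cls (\<zeta> s)) (cls (\<zeta> t)) = \<bar>s - t\<bar>" if "s \<in> {0..?L}" "t \<in> {0..?L}" for s t
      using iso[of s t] iso[of t s] that mdist_commute[of Con "cls (\<zeta> s)" "cls (\<zeta> t)"]
      by (cases "s \<le> t") simp_all
  qed
qed

end

subsection \<open>Isometric actions with a metric quotient\<close>

text \<open>The interface between groups and cones: it is instantiated by \<open>N\<close> acting on
  \<open>G\<close> over the quotient, and again by the cones. In \<open>lift\<close> the distance
  between fibres is attained, not merely approximated.\<close>

locale orbit_fibration =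
  fixes X :: "'a metric" and A :: "'c metric" and Y :: "'b metric"
    and act :: "'c \<Rightarrow> 'a \<Rightarrow> 'a" and p :: "'a \<Rightarrow> 'b"
  assumes act_in: "a \<in> mspace A \<Longrightarrow> x \<in> mspace X \<Longrightarrow> act a x \<in> mspace X"
    and act_orbit: "a \<in> mspace A \<Longrightarrow> b \<in> mspace A \<Longrightarrow> x \<in> mspace X \<Longrightarrow>
      mdist X (act a x) (act b x) = mdist A a b"
    and act_isometry: "a \<in> mspace A \<Longrightarrow> x \<in> mspace X \<Longrightarrow> y \<in> mspace X \<Longrightarrow>
      mdist X (act a x) (act a y) = mdist X x y"
    and p_in: "x \<in> mspace X \<Longrightarrow> p x \<in> mspace Y"
    and p_act: "a \<in> mspace A \<Longrightarrow> x \<in> mspace X \<Longrightarrow> p (act a x) = p x"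
    and p_lipschitz: "x \<in> mspace X \<Longrightarrow> y \<in> mspace X \<Longrightarrow> mdist Y (p x) (p y) \<le> mdist X x y"
    and fibre: "x \<in> mspace X \<Longrightarrow> y \<in> mspace X \<Longrightarrow> p x = p y \<Longrightarrow> \<exists>a\<in>mspace A. act a x = y"
    and lift: "x \<in> mspace X \<Longrightarrow> t \<in> mspace Y \<Longrightarrow>
      \<exists>y\<in>mspace X. p y = t \<and> mdist X x y \<le> mdist Y (p x) t"
begin

lemma act_dist_le:
  assumes "a \<in> mspace A" "b \<in> mspace A" "x \<in> mspace X" "y \<in> mspace X"
  shows "mdist X (act a x) (act b y) \<le> mdist A a b + mdist X x y"
  using mdist_triangle[of "act a x" X "act b x" "act b y"] act_in act_orbit act_isometry assms by simp

text \<open>Every point of a fibre is reached from its section point by the action, and the orbit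
  maps are isometric, so the action and the section give coordinates on \<open>X\<close>.\<close>

lemma bilipschitz_of_section:
  assumes \<sigma>: "\<And>t. t \<in> mspace Y \<Longrightarrow> \<sigma> t \<in> mspace X" "\<And>t. t \<in> mspace Y \<Longrightarrow> p (\<sigma> t) = t"
    and \<sigma>_iso: "\<And>s t. s \<in> mspace Y \<Longrightarrow> t \<in> mspace Y \<Longrightarrow> mdist X (\<sigma> s) (\<sigma> t) = mdist Y s t"
  shows "bilipschitz_equivalent X (sum_metric A Y)"
proof -
  let ?Z = "mspace A \<times> mspace Y"
  define g where "g z = act (fst z) (\<sigma> (snd z))" for z
  have g_in: "g z \<in> mspace X" and p_g: "p (g z) = snd z" if "z \<in> ?Z" for z
    using that \<sigma> act_in p_act by (auto simp: g_def)
  have upper: "mdist X (g z) (g w) \<le> mdist (sum_metric A Y) z w" if "z \<in> ?Z" "w \<in> ?Z" for z w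
    using that act_dist_le[of "fst z" "fst w" "\<sigma> (snd z)" "\<sigma> (snd w)"] \<sigma> \<sigma>_iso
    by (auto simp: g_def)
  \<comment> \<open>The projection bounds the \<open>Y\<close> part by the distance in
    \<open>X\<close>. Moving \<open>\<sigma> t\<close> to \<open>\<sigma> s\<close> under the same
    \<open>b\<close> costs that much once more, so the \<open>A\<close> part is at most twice the
    distance: 3 in total.\<close>
  have lower: "mdist (sum_metric A Y) z w \<le> 3 * mdist X (g z) (g w)" if zw: "z \<in> ?Z" "w \<in> ?Z" for z w
  proof -
    obtain a s b t where z: "z = (a, s)" and w: "w = (b, t)" by fastforce
    have mem: "a \<in> mspace A" "b \<in> mspace A" "s \<in> mspace Y" "t \<in> mspace Y" using zw z w by auto
    have Y: "mdist Y s t \<le> mdist X (g z) (g w)"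
      using p_lipschitz[OF g_in[OF zw(1)] g_in[OF zw(2)]] p_g zw z w by simp
    have "mdist A a b = mdist X (act a (\<sigma> s)) (act b (\<sigma> s))" using act_orbit \<sigma> mem by simp
    also have "\<dots> \<le> mdist X (act a (\<sigma> s)) (act b (\<sigma> t)) + mdist X (act b (\<sigma> t)) (act b (\<sigma> s))"
      using act_in \<sigma> mem by (intro mdist_triangle) auto
    also have "\<dots> = mdist X (g z) (g w) + mdist Y s t"
      using act_isometry \<sigma> \<sigma>_iso mem mdist_commute[of Y s t] by (simp add: g_def z w)
    finally show ?thesis using Y z w by simp
  qed
  have inj: "inj_on g ?Z"
  proof (rule inj_onI)
    fix z w assume zw: "z \<in> ?Z" "w \<in> ?Z" "g z = g w"
    then have "mdist X (g z) (g w) = 0" using g_in by simp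
    then have "mdist (sum_metric A Y) z w = 0"
      using lower[OF zw(1,2)] mdist_nonneg[of "sum_metric A Y" z w] by linarith
    then show "z = w" using zw by (metis mdist_zero mspace_sum_metric)
  qed
  have "g ` ?Z = mspace X"
  proof
    show "g ` ?Z \<subseteq> mspace X" using g_in by blast
    show "mspace X \<subseteq> g ` ?Z"
    proof
      fix x assume x: "x \<in> mspace X"
      obtain a where "a \<in> mspace A" "act a (\<sigma> (p x)) = x"
        using fibre[OF \<sigma>(1) x, OF p_in[OF x]] \<sigma>(2) p_in[OF x] by blast
      then show "x \<in> g ` ?Z" using p_in[OF x] by (intro image_eqI[of _ _ "(a, p x)"]) (auto simp: g_def)
    qed
  qed
  then have bij: "bij_betw g ?Z (mspace X)" using inj by (simp add: bij_betw_def)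
  let ?f = "inv_into ?Z g"
  have f: "bij_betw ?f (mspace X) ?Z" by (rule bij_betw_inv_into[OF bij])
  have f_in: "?f x \<in> ?Z" and g_f: "g (?f x) = x" if "x \<in> mspace X" for x
    using bij_betwE[OF f] bij_betw_inv_into_right[OF bij] that by auto
  show ?thesis
    unfolding bilipschitz_equivalent_def
  proof (intro exI[of _ ?f] exI[of _ 3] conjI ballI)
    show "bij_betw ?f (mspace X) (mspace (sum_metric A Y))" using f by simp
    fix x y assume xy: "x \<in> mspace X" "y \<in> mspace X"
    show "mdist (sum_metric A Y) (?f x) (?f y) \<le> 3 * mdist X x y"
      using lower[OF f_in f_in, OF xy] g_f xy by simp
    have "mdist X x y \<le> mdist (sum_metric A Y) (?f x) (?f y)"
      using upper[OF f_in f_in, OF xy] g_f xy by simp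
    then show "mdist X x y / 3 \<le> mdist (sum_metric A Y) (?f x) (?f y)"
      using mdist_nonneg[of X x y] by linarith
  qed simp
qed

lemma bilipschitz_of_real_tree:
  assumes "real_tree Y" "geodesic_space X" "mcomplete_of X" "mspace X \<noteq> {}"
  shows "bilipschitz_equivalent X (sum_metric A Y)"
proof -
  obtain x0 where "x0 \<in> mspace X" using assms(4) by blast
  from real_tree_section[OF assms(1-3) p_in p_lipschitz lift this]
  obtain \<sigma> where "\<And>t. t \<in> mspace Y \<Longrightarrow> \<sigma> t \<in> mspace X" "\<And>t. t \<in> mspace Y \<Longrightarrow> p (\<sigma> t) = t"
    "\<And>s t. s \<in> mspace Y \<Longrightarrow> t \<in> mspace Y \<Longrightarrow> mdist X (\<sigma> s) (\<sigma> t) = mdist Y s t"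
    by blast
  then show ?thesis by (rule bilipschitz_of_section)
qed

end

section \<open>Orbit fibrations of asymptotic cones\<close>

context cone
begin

text \<open>Chosen representatives turn termwise maps into functions on cone points;
  \<open>cone_p_cls\<close> and \<open>cone_act_cls\<close> show that the choice does not
  matter.\<close>

definition rep :: "(nat \<Rightarrow> 'a) set \<Rightarrow> nat \<Rightarrow> 'a" where
  "rep U = (SOME x. x \<in> seqs \<and> U = cls x)"

lemma rep_in: "U \<in> mspace Con \<Longrightarrow> rep U \<in> seqs"
  and cls_of_rep: "U \<in> mspace Con \<Longrightarrow> cls (rep U) = U"
  using someI_ex[of "\<lambda>x. x \<in> seqs \<and> U = cls x"] cls_rep[of U] unfolding rep_def by metis+

lemma rep_cls_tendsto:
  assumes "x \<in> seqs"
  shows "((\<lambda>n. mdist X (rep (cls x) n) (x n) / d n) \<longlongrightarrow> 0) \<omega>"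
  using cls_eq_iff[OF rep_in[OF cls_in[OF assms]] assms] cls_of_rep[OF cls_in[OF assms]] by simp

end

text \<open>The base point conditions transfer boundedness: \<open>a0\<close> fixes every point, so
  an element \<open>a\<close> displaces any point by exactly its distance from
  \<open>a0\<close>.\<close>

locale cone_fibration =
  orbit_fibration X A Y act p + X: cone X x0 \<omega> d + A: cone A a0 \<omega> d + Y: cone Y y0 \<omega> d
  for X :: "'a metric" and A :: "'c metric" and Y :: "'b metric"
    and act :: "'c \<Rightarrow> 'a \<Rightarrow> 'a" and p :: "'a \<Rightarrow> 'b" and x0 a0 y0 \<omega> d +
  assumes act_base: "x \<in> mspace X \<Longrightarrow> act a0 x = x"
    and p_base: "p x0 = y0"
begin

definition cone_act :: "(nat \<Rightarrow> 'c) set \<Rightarrow> (nat \<Rightarrow> 'a) set \<Rightarrow> (nat \<Rightarrow> 'a) set" where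
  "cone_act W U = X.cls (\<lambda>n. act (A.rep W n) (X.rep U n))"

definition cone_p :: "(nat \<Rightarrow> 'a) set \<Rightarrow> (nat \<Rightarrow> 'b) set" where
  "cone_p U = Y.cls (\<lambda>n. p (X.rep U n))"

lemma act_seqs:
  assumes a: "a \<in> A.seqs" and x: "x \<in> X.seqs"
  shows "(\<lambda>n. act (a n) (x n)) \<in> X.seqs"
proof -
  obtain B where B: "\<And>n. mdist A a0 (a n) / d n \<le> B" using a by (auto simp: cone_seqs_def)
  show ?thesis
  proof (rule X.seqs_near[OF x])
    show "act (a n) (x n) \<in> mspace X" for n
      using act_in A.seqs_in[OF a] X.seqs_in[OF x] by blast
    have "mdist X (x n) (act (a n) (x n)) = mdist A a0 (a n)" for n
      using act_orbit[OF A.base A.seqs_in[OF a] X.seqs_in[OF x], of n n] act_base[OF X.seqs_in[OF x]]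
      by simp
    then show "mdist X (x n) (act (a n) (x n)) \<le> B * d n" for n
      using B[of n] X.d_pos[of n] by (simp add: pos_divide_le_eq)
  qed
qed

lemma p_seqs:
  assumes x: "x \<in> X.seqs"
  shows "(\<lambda>n. p (x n)) \<in> Y.seqs"
proof -
  obtain B where B: "\<And>n. mdist X x0 (x n) / d n \<le> B" using x by (auto simp: cone_seqs_def)
  have "mdist Y y0 (p (x n)) / d n \<le> B" for n
  proof -
    have "mdist Y y0 (p (x n)) / d n \<le> mdist X x0 (x n) / d n"
      using p_lipschitz[OF X.base X.seqs_in[OF x], of n] X.d_pos[of n] p_base
      by (intro divide_right_mono) (auto simp: less_imp_le)
    then show ?thesis using B[of n] by linarith
  qed
  then show ?thesis using p_in X.seqs_in[OF x] by (auto simp: cone_seqs_def)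
qed

lemma cone_p_cls:
  assumes x: "x \<in> X.seqs"
  shows "cone_p (X.cls x) = Y.cls (\<lambda>n. p (x n))"
proof -
  let ?r = "X.rep (X.cls x)"
  have r: "?r \<in> X.seqs" by (rule X.rep_in[OF X.cls_in[OF x]])
  have "mdist Y.Con (Y.cls (\<lambda>n. p (?r n))) (Y.cls (\<lambda>n. p (x n))) \<le> 0"
    by (rule Y.cls_dist_le[OF p_seqs[OF r] p_seqs[OF x] X.rep_cls_tendsto[OF x]])
      (use p_lipschitz X.seqs_in[OF r] X.seqs_in[OF x] X.d_pos in
        \<open>auto intro!: always_eventually divide_right_mono simp: less_imp_le\<close>)
  then show ?thesis
    using mdist_zero[OF Y.cls_in[OF p_seqs[OF r]] Y.cls_in[OF p_seqs[OF x]]]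
    by (metis cone_p_def mdist_nonneg order_antisym)
qed

lemma cone_act_cls:
  assumes a: "a \<in> A.seqs" and x: "x \<in> X.seqs"
  shows "cone_act (A.cls a) (X.cls x) = X.cls (\<lambda>n. act (a n) (x n))"
proof -
  let ?b = "A.rep (A.cls a)" and ?r = "X.rep (X.cls x)"
  have b: "?b \<in> A.seqs" by (rule A.rep_in[OF A.cls_in[OF a]])
  have r: "?r \<in> X.seqs" by (rule X.rep_in[OF X.cls_in[OF x]])
  have lim: "((\<lambda>n. mdist A (?b n) (a n) / d n + mdist X (?r n) (x n) / d n) \<longlongrightarrow> 0) \<omega>"
    using tendsto_add[OF A.rep_cls_tendsto[OF a] X.rep_cls_tendsto[OF x]] by simp
  have "mdist X (act (?b n) (?r n)) (act (a n) (x n)) / d n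
      \<le> mdist A (?b n) (a n) / d n + mdist X (?r n) (x n) / d n" for n
    using divide_right_mono[OF act_dist_le[OF A.seqs_in[OF b] A.seqs_in[OF a] X.seqs_in[OF r] X.seqs_in[OF x]]]
      X.d_pos[of n] by (simp add: add_divide_distrib less_imp_le)
  then have "mdist X.Con (X.cls (\<lambda>n. act (?b n) (?r n))) (X.cls (\<lambda>n. act (a n) (x n))) \<le> 0"
    by (intro X.cls_dist_le[OF act_seqs[OF b r] act_seqs[OF a x] lim] always_eventually) simp
  then show ?thesis
    using mdist_zero[OF X.cls_in[OF act_seqs[OF b r]] X.cls_in[OF act_seqs[OF a x]]]
    by (metis cone_act_def mdist_nonneg order_antisym)
qed

lemma lift_seqs:
  assumes x: "x \<in> X.seqs" and t: "t \<in> Y.seqs"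
  obtains y where "y \<in> X.seqs" "\<And>n. p (y n) = t n" "\<And>n. mdist X (x n) (y n) \<le> mdist Y (p (x n)) (t n)"
proof -
  have "\<forall>n. \<exists>y. y \<in> mspace X \<and> p y = t n \<and> mdist X (x n) y \<le> mdist Y (p (x n)) (t n)"
    using lift[OF X.seqs_in[OF x] Y.seqs_in[OF t]] by blast
  then obtain y where y: "\<And>n. y n \<in> mspace X" "\<And>n. p (y n) = t n"
    "\<And>n. mdist X (x n) (y n) \<le> mdist Y (p (x n)) (t n)"
    by metis
  obtain B where B: "\<And>n. mdist Y (p (x n)) (t n) / d n \<le> B"
    using Y.seqs_bound[OF p_seqs[OF x] t] by blast
  have "mdist X (x n) (y n) \<le> B * d n" for n
    using y(3)[of n] B[of n] X.d_pos[of n] by (simp add: pos_divide_le_eq)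
  then have "y \<in> X.seqs" by (rule X.seqs_near[OF x y(1)])
  then show ?thesis using y that by blast
qed

text \<open>The distance relations hold index by index and pass to the limit, and lifts can be
  chosen index by index. Only \<open>fibre\<close> needs a correction of representatives.\<close>

lemma orbit_fibration_cones: "orbit_fibration X.Con A.Con Y.Con cone_act cone_p"
proof
  fix W W' U V
  assume U: "U \<in> mspace X.Con"
  obtain x where x: "x \<in> X.seqs" "U = X.cls x" using X.cls_rep[OF U] by blast
  show "cone_p U \<in> mspace Y.Con" using cone_p_cls p_seqs Y.cls_in x by simp
  {
    assume W: "W \<in> mspace A.Con"
    obtain a where a: "a \<in> A.seqs" "W = A.cls a" using A.cls_rep[OF W] by blast
    show "cone_act W U \<in> mspace X.Con" using cone_act_cls act_seqs X.cls_in a x by simp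
    have "p (act (a n) (x n)) = p (x n)" for n
      using p_act A.seqs_in[OF a(1)] X.seqs_in[OF x(1)] by blast
    then show "cone_p (cone_act W U) = cone_p U"
      using a x by (simp add: cone_act_cls cone_p_cls act_seqs)
    {
      assume W': "W' \<in> mspace A.Con"
      obtain b where b: "b \<in> A.seqs" "W' = A.cls b" using A.cls_rep[OF W'] by blast
      have eq: "mdist X (act (a n) (x n)) (act (b n) (x n)) = mdist A (a n) (b n)" for n
        using act_orbit A.seqs_in[OF a(1)] A.seqs_in[OF b(1)] X.seqs_in[OF x(1)] by blast
      have "mdist X.Con (X.cls (\<lambda>n. act (a n) (x n))) (X.cls (\<lambda>n. act (b n) (x n))) = mdist A.Con W W'"
        by (rule X.cls_dist_eqI[OF act_seqs act_seqs])
          (use a b x A.cls_dist[OF a(1) b(1)] in \<open>simp_all add: eq\<close>)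
      then show "mdist X.Con (cone_act W U) (cone_act W' U) = mdist A.Con W W'"
        using a b x by (simp add: cone_act_cls)
    }
    assume V: "V \<in> mspace X.Con"
    obtain y where y: "y \<in> X.seqs" "V = X.cls y" using X.cls_rep[OF V] by blast
    have eq: "mdist X (act (a n) (x n)) (act (a n) (y n)) = mdist X (x n) (y n)" for n
      using act_isometry A.seqs_in[OF a(1)] X.seqs_in[OF x(1)] X.seqs_in[OF y(1)] by blast
    have "mdist X.Con (X.cls (\<lambda>n. act (a n) (x n))) (X.cls (\<lambda>n. act (a n) (y n))) = mdist X.Con U V"
      by (rule X.cls_dist_eqI[OF act_seqs act_seqs])
        (use a x y X.cls_dist[OF x(1) y(1)] in \<open>simp_all add: eq\<close>)
    then show "mdist X.Con (cone_act W U) (cone_act W V) = mdist X.Con U V"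
      using a x y by (simp add: cone_act_cls)
  }
  {
    assume V: "V \<in> mspace X.Con"
    obtain y where y: "y \<in> X.seqs" "V = X.cls y" using X.cls_rep[OF V] by blast
    have "mdist Y.Con (Y.cls (\<lambda>n. p (x n))) (Y.cls (\<lambda>n. p (y n))) \<le> mdist X.Con U V"
      unfolding x(2) y(2)
      by (rule Y.cls_dist_le[OF p_seqs[OF x(1)] p_seqs[OF y(1)] X.cls_dist[OF x(1) y(1)]])
        (use p_lipschitz X.seqs_in[OF x(1)] X.seqs_in[OF y(1)] X.d_pos in
          \<open>auto intro!: always_eventually divide_right_mono simp: less_imp_le\<close>)
    then show "mdist Y.Con (cone_p U) (cone_p V) \<le> mdist X.Con U V"
      using x y by (simp add: cone_p_cls)
    assume pUV: "cone_p U = cone_p V"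
    \<comment> \<open>Equal images in the cone only mean that \<open>p (x n)\<close> and
      \<open>p (y n)\<close> are close at scale \<open>d n\<close>, so \<open>x n\<close> and
      \<open>y n\<close> may lie in different fibres. Lifting \<open>p (y n)\<close> from
      \<open>x n\<close> yields another representative of \<open>U\<close> that lies exactly in the
      fibres of \<open>y\<close>.\<close>
    obtain z where z: "z \<in> X.seqs" "\<And>n. p (z n) = p (y n)"
      "\<And>n. mdist X (x n) (z n) \<le> mdist Y (p (x n)) (p (y n))"
      using lift_seqs[OF x(1) p_seqs[OF y(1)]] by metis
    have "Y.cls (\<lambda>n. p (x n)) = Y.cls (\<lambda>n. p (y n))" using pUV x y by (simp add: cone_p_cls)
    then have lim: "((\<lambda>n. mdist Y (p (x n)) (p (y n)) / d n) \<longlongrightarrow> 0) \<omega>"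
      using Y.cls_eq_iff[OF p_seqs[OF x(1)] p_seqs[OF y(1)]] by simp
    have "mdist X.Con (X.cls x) (X.cls z) \<le> 0"
      by (rule X.cls_dist_le[OF x(1) z(1) lim])
        (use z(3) X.d_pos in \<open>auto intro!: always_eventually divide_right_mono simp: less_imp_le\<close>)
    then have xz: "X.cls x = X.cls z"
      using mdist_zero[OF X.cls_in[OF x(1)] X.cls_in[OF z(1)]] by (metis mdist_nonneg order_antisym)
    have "\<forall>n. \<exists>a. a \<in> mspace A \<and> act a (z n) = y n"
      using fibre[OF X.seqs_in[OF z(1)] X.seqs_in[OF y(1)] z(2)] by blast
    then obtain a where a: "\<And>n. a n \<in> mspace A" "\<And>n. act (a n) (z n) = y n" by metis
    obtain B where B: "\<And>n. mdist X (z n) (y n) / d n \<le> B"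
      using X.seqs_bound[OF z(1) y(1)] by blast
    \<comment> \<open>By the orbit isometry, the size of \<open>a n\<close> is the distance by which
      it moves \<open>z n\<close>.\<close>
    have "mdist A a0 (a n) / d n \<le> B" for n
      using act_orbit[OF A.base a(1) X.seqs_in[OF z(1)], of n n] act_base[OF X.seqs_in[OF z(1)], of n]
        a(2)[of n] B[of n] by simp
    then have "a \<in> A.seqs" using a(1) by (auto simp: cone_seqs_def)
    moreover then have "cone_act (A.cls a) U = V"
      using cone_act_cls[of a z] z(1) a(2) x y xz by simp
    ultimately show "\<exists>a\<in>mspace A.Con. cone_act a U = V" using A.cls_in by blast
  }
  fix T assume T: "T \<in> mspace Y.Con"
  obtain t where t: "t \<in> Y.seqs" "T = Y.cls t" using Y.cls_rep[OF T] by blast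
  obtain z where z: "z \<in> X.seqs" "\<And>n. p (z n) = t n"
    "\<And>n. mdist X (x n) (z n) \<le> mdist Y (p (x n)) (t n)"
    using lift_seqs[OF x(1) t(1)] by metis
  have "mdist X.Con (X.cls x) (X.cls z) \<le> mdist Y.Con (Y.cls (\<lambda>n. p (x n))) (Y.cls t)"
    by (rule X.cls_dist_le[OF x(1) z(1) Y.cls_dist[OF p_seqs[OF x(1)] t(1)]])
      (use z(3) X.d_pos in \<open>auto intro!: always_eventually divide_right_mono simp: less_imp_le\<close>)
  then show "\<exists>V\<in>mspace X.Con. cone_p V = T \<and> mdist X.Con U V \<le> mdist Y.Con (cone_p U) T"
    using x t z X.cls_in by (intro bexI[of _ "X.cls z"]) (auto simp: cone_p_cls)
qed

end

subsection \<open>Word metrics and quotients\<close>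

locale word_group = group G for G :: "('a, 'b) monoid_scheme" (structure) +
  fixes S :: "'a set"
  assumes S: "S \<subseteq> carrier G" and gen: "generate G S = carrier G"
begin

abbreviation "letters \<equiv> S \<union> m_inv G ` S"
abbreviation word :: "'a list \<Rightarrow> 'a" where "word ws \<equiv> foldr (\<otimes>) ws \<one>"

lemma letters: "letters \<subseteq> carrier G"
  using S by auto

lemma word_closed: "set ws \<subseteq> letters \<Longrightarrow> word ws \<in> carrier G"
  using letters by (induction ws) auto

lemma word_append:
  assumes "set us \<subseteq> letters" "set vs \<subseteq> letters"
  shows "word (us @ vs) = word us \<otimes> word vs"
  using assms
proof (induction us)
  case Nil
  then show ?case using word_closed[of vs] by simp
next
  case (Cons a us)
  moreover have "a \<in> carrier G" using Cons.prems letters by auto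
  ultimately show ?case using word_closed[of us] word_closed[of vs] by (simp add: m_assoc)
qed

lemma word_length_le: "set ws \<subseteq> letters \<Longrightarrow> word_length G S (word ws) \<le> length ws"
  unfolding word_length_def by (rule Least_le) blast

lemma geodesic_word:
  assumes "g \<in> carrier G"
  obtains ws where "set ws \<subseteq> letters" "length ws = word_length G S g" "word ws = g"
proof -
  have "\<exists>ws. set ws \<subseteq> letters \<and> word ws = g" if "g \<in> generate G S"
    using that
  proof induction
    case one
    show ?case by (intro exI[of _ "[]"]) simp
  next
    case (incl h)
    then show ?case using S by (intro exI[of _ "[h]"]) auto
  next
    case (inv h)
    then show ?case using S by (intro exI[of _ "[inv h]"]) auto
  next
    case (eng g h)
    then obtain us vs where "set us \<subseteq> letters" "word us = g" "set vs \<subseteq> letters" "word vs = h" by blast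
    then show ?case using word_append[of us vs] by (intro exI[of _ "us @ vs"]) auto
  qed
  then have "\<exists>n ws. set ws \<subseteq> letters \<and> length ws = n \<and> word ws = g" using assms gen by blast
  from LeastI_ex[OF this] show ?thesis unfolding word_length_def[symmetric] using that by blast
qed

lemmas mspace_word = mspace_word_metric[OF is_group S gen]
lemmas mdist_word = mdist_word_metric[OF is_group S gen]

lemma word_length_one [simp]: "word_length G S \<one> = 0"
  using word_length_le[of "[]"] by simp

lemma mdist_word_left_mult:
  assumes "g \<in> carrier G" "h \<in> carrier G" "k \<in> carrier G"
  shows "mdist (word_metric G S) (k \<otimes> g) (k \<otimes> h) = mdist (word_metric G S) g h"
proof -
  have "inv (k \<otimes> g) \<otimes> (k \<otimes> h) = inv g \<otimes> (inv k \<otimes> (k \<otimes> h))"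
    using assms by (simp add: inv_mult_group m_assoc)
  also have "\<dots> = inv g \<otimes> h" using assms by (simp flip: m_assoc)
  finally show ?thesis using assms by (simp add: mdist_word)
qed

text \<open>The path follows the prefixes of a shortest word. By left invariance the distance
  between two prefixes is the length of the subword between them as an element, hence at most its
  number of letters.\<close>

lemma discrete_geodesic:
  assumes g: "g \<in> carrier G" and h: "h \<in> carrier G"
  shows "\<exists>f :: nat \<Rightarrow> 'a. f 0 = g \<and> range f \<subseteq> carrier G \<and>
    (\<forall>i j. mdist (word_metric G S) (f i) (f j) \<le> \<bar>real i - real j\<bar>) \<and>
    (\<forall>i. mdist (word_metric G S) g h \<le> real i \<longrightarrow> f i = h)"
proof -
  obtain ws where ws: "set ws \<subseteq> letters" "length ws = word_length G S (inv g \<otimes> h)" "word ws = inv g \<otimes> h"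
    using geodesic_word[of "inv g \<otimes> h"] g h by blast
  define f where "f i = g \<otimes> word (take i ws)" for i
  have sub: "set (take i ws) \<subseteq> letters" for i using ws(1) set_take_subset by fast
  have f_in: "f i \<in> carrier G" for i using g word_closed[OF sub] by (simp add: f_def)
  have le: "mdist (word_metric G S) (f i) (f j) \<le> real j - real i" if "i \<le> j" for i j
  proof -
    let ?v = "drop i (take j ws)"
    have v: "set ?v \<subseteq> letters" using sub[of j] set_drop_subset by fast
    have "take j ws = take i ws @ ?v"
      using that append_take_drop_id[of i "take j ws"] by (simp add: min_absorb1)
    then have "word (take j ws) = word (take i ws) \<otimes> word ?v" using word_append[OF sub v] by metis
    then have "mdist (word_metric G S) (f i) (f j)
        = mdist (word_metric G S) (word (take i ws) \<otimes> \<one>) (word (take i ws) \<otimes> word ?v)"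
      using g word_closed[OF sub] word_closed[OF v] by (simp add: f_def mdist_word_left_mult)
    also have "\<dots> = real (word_length G S (word ?v))"
      using mdist_word_left_mult[OF one_closed word_closed[OF v] word_closed[OF sub]] word_closed[OF v]
      by (simp add: mdist_word)
    also have "\<dots> \<le> real (length ?v)" using word_length_le[OF v] by simp
    also have "\<dots> \<le> real j - real i" using that by simp
    finally show ?thesis .
  qed
  have "mdist (word_metric G S) (f i) (f j) \<le> \<bar>real i - real j\<bar>" for i j
    using le[of i j] le[of j i] mdist_commute[of "word_metric G S" "f i" "f j"] by (cases "i \<le> j") auto
  \<comment> \<open>Past its end, \<open>take\<close> returns the whole word, so the path waits at
    \<open>h\<close>.\<close>
  moreover have "f i = h" if "mdist (word_metric G S) g h \<le> real i" for i
    using that g h ws(2,3) by (simp add: f_def mdist_word flip: m_assoc)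
  moreover have "f 0 = g" using g by (simp add: f_def)
  ultimately show ?thesis using f_in by (intro exI[of _ f]) auto
qed

end

section \<open>Words under a homomorphism that maps generators to generators\<close>

locale word_group_hom = G: word_group G S + H: word_group H "h ` S" + group_hom G H h
  for G :: "('a, 'c) monoid_scheme" (structure) and H :: "('b, 'd) monoid_scheme" (structure)
    and S :: "'a set" and h :: "'a \<Rightarrow> 'b"
begin

lemma letters_image: "H.letters = h ` G.letters"
  using G.S by (auto simp: image_Un image_image subset_iff)

lemma word_map: "set ws \<subseteq> G.letters \<Longrightarrow> H.word (map h ws) = h (G.word ws)"
proof (induction ws)
  case (Cons a ws)
  moreover have "a \<in> carrier G" using Cons.prems G.letters by auto
  ultimately show ?case using G.word_closed[of ws] by simp
qed simp

lemma word_length_image_le: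
  assumes "g \<in> carrier G"
  shows "word_length H (h ` S) (h g) \<le> word_length G S g"
proof -
  obtain ws where ws: "set ws \<subseteq> G.letters" "length ws = word_length G S g" "G.word ws = g"
    using G.geodesic_word[OF assms] .
  have "set (map h ws) \<subseteq> H.letters" using ws(1) letters_image by auto
  then show ?thesis using H.word_length_le[of "map h ws"] word_map[OF ws(1)] ws(2,3) by simp
qed

text \<open>A shortest word for \<open>k\<close> is lifted letter by letter, which keeps its length.
  This is why distances between fibres are attained.\<close>

lemma word_length_lift:
  assumes "k \<in> carrier H"
  obtains g where "g \<in> carrier G" "h g = k" "word_length G S g \<le> word_length H (h ` S) k"
proof -
  obtain vs where vs: "set vs \<subseteq> H.letters" "length vs = word_length H (h ` S) k" "H.word vs = k"
    using H.geodesic_word[OF assms] .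
  then have "vs \<in> map h ` lists G.letters"
    unfolding letters_image lists_image[symmetric] by (simp add: lists_eq_set)
  then obtain ws where ws: "set ws \<subseteq> G.letters" "vs = map h ws" by (auto simp: lists_eq_set)
  show ?thesis
    using that[of "G.word ws"] G.word_closed[OF ws(1)] G.word_length_le[OF ws(1)] word_map[OF ws(1)] ws vs
    by simp
qed

lemma mdist_image_le:
  assumes "x \<in> carrier G" "y \<in> carrier G"
  shows "mdist (word_metric H (h ` S)) (h x) (h y) \<le> mdist (word_metric G S) x y"
  using assms word_length_image_le[of "inv\<^bsub>G\<^esub> x \<otimes>\<^bsub>G\<^esub> y"]
  by (simp add: G.mdist_word H.mdist_word)

lemma mdist_lift:
  assumes x: "x \<in> carrier G" and t: "t \<in> carrier H"
  shows "\<exists>y\<in>carrier G. h y = t \<and> mdist (word_metric G S) x y \<le> mdist (word_metric H (h ` S)) (h x) t"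
proof -
  have "inv\<^bsub>H\<^esub> h x \<otimes>\<^bsub>H\<^esub> t \<in> carrier H" using assms by simp
  then obtain g where g: "g \<in> carrier G" "h g = inv\<^bsub>H\<^esub> h x \<otimes>\<^bsub>H\<^esub> t"
    "word_length G S g \<le> word_length H (h ` S) (inv\<^bsub>H\<^esub> h x \<otimes>\<^bsub>H\<^esub> t)"
    by (rule word_length_lift)
  have "h (x \<otimes>\<^bsub>G\<^esub> g) = t" using assms g by (simp flip: H.m_assoc)
  moreover have "inv\<^bsub>G\<^esub> x \<otimes>\<^bsub>G\<^esub> (x \<otimes>\<^bsub>G\<^esub> g) = g" using assms g by (simp flip: G.m_assoc)
  ultimately show ?thesis
    using assms g by (intro bexI[of _ "x \<otimes>\<^bsub>G\<^esub> g"]) (simp_all add: G.mdist_word H.mdist_word)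
qed

end

section \<open>The central extension and its cones\<close>

theorem theorem1p2:
  fixes G :: "('a, 'b) monoid_scheme"
    and S N :: "'a set"
    and \<omega> :: "nat filter"
    and d :: "nat \<Rightarrow> real"
  assumes "group G"
    and "S \<subseteq> carrier G" and "finite S" and "generate G S = carrier G"
    and "subgroup N G"
    and "\<And>n g. n \<in> N \<Longrightarrow> g \<in> carrier G \<Longrightarrow> n \<otimes>\<^bsub>G\<^esub> g = g \<otimes>\<^bsub>G\<^esub> n"
    and "nonprincipal_ultrafilter \<omega>"
    and "scaling_sequence d"
    and "real_tree
           (asymptotic_cone \<omega> (word_metric (G Mod N) ((\<lambda>g. N #>\<^bsub>G\<^esub> g) ` S)) \<one>\<^bsub>G Mod N\<^esub> d)"
  shows "bilipschitz_equivalent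
           (asymptotic_cone \<omega> (word_metric G S) \<one>\<^bsub>G\<^esub> d)
           (sum_metric
              (asymptotic_cone \<omega> (submetric (word_metric G S) N) \<one>\<^bsub>G\<^esub> d)
              (asymptotic_cone \<omega> (word_metric (G Mod N) ((\<lambda>g. N #>\<^bsub>G\<^esub> g) ` S))
                 \<one>\<^bsub>G Mod N\<^esub> d))"
proof -
  note central = assms(6)
  interpret G: word_group G S using assms(1,2,4) by (simp add: word_group_def word_group_axioms_def)
  let ?q = "\<lambda>g. N #>\<^bsub>G\<^esub> g"
  have normal: "N \<lhd> G"
  proof (rule G.normalI[OF assms(5)])
    show "\<forall>x\<in>carrier G. N #>\<^bsub>G\<^esub> x = x <#\<^bsub>G\<^esub> N"
      unfolding r_coset_def l_coset_def
      by (intro ballI SUP_cong refl arg_cong[where f = "\<lambda>z. {z}"] central)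
  qed
  interpret N: normal N G by (rule normal)
  interpret Q: word_group "G Mod N" "?q ` S"
    using N.factorgroup_is_group G.S generate_quotient[OF normal G.S G.gen]
    by (auto simp: word_group_def word_group_axioms_def carrier_FactGroup)
  interpret q: word_group_hom G "G Mod N" S ?q
    using N.r_coset_hom_Mod
    by unfold_locales
  let ?X = "word_metric G S" and ?Y = "word_metric (G Mod N) (?q ` S)"
  let ?A = "submetric ?X N"
  note mspace [simp] = G.mspace_word Q.mspace_word
  have A: "mspace ?A = N" using N.subset by auto
  \<comment> \<open>Word metrics are invariant under left multiplication only. Centrality moves the
    common factor \<open>x\<close> to the left; this is what makes orbit maps isometric.\<close>
  have orbit: "mdist ?X (a \<otimes>\<^bsub>G\<^esub> x) (b \<otimes>\<^bsub>G\<^esub> x) = mdist ?X a b"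
    if "a \<in> N" "b \<in> N" "x \<in> carrier G" for a b x
    using that central[OF that(1,3)] central[OF that(2,3)] G.mdist_word_left_mult[of a b x] by simp
  interpret orbit_fibration ?X ?A ?Y "(\<otimes>\<^bsub>G\<^esub>)" ?q
  proof
    fix a b x y t
    show "mdist ?X (a \<otimes>\<^bsub>G\<^esub> x) (b \<otimes>\<^bsub>G\<^esub> x) = mdist ?A a b"
      if "a \<in> mspace ?A" "b \<in> mspace ?A" "x \<in> mspace ?X"
      using that orbit by simp
    show "?q (a \<otimes>\<^bsub>G\<^esub> x) = ?q x" if "a \<in> mspace ?A" "x \<in> mspace ?X"
      using that G.coset_mult_assoc[OF N.subset, of a x] N.rcos_const[OF G.is_group] by simp
    show "\<exists>a\<in>mspace ?A. a \<otimes>\<^bsub>G\<^esub> x = y" if "x \<in> mspace ?X" "y \<in> mspace ?X" "?q x = ?q y"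
    proof -
      \<comment> \<open>The fibres of the quotient map are the cosets, which are the orbits of
        \<open>N\<close> under multiplication.\<close>
      have "y \<in> ?q x" using that G.rcos_self[OF _ N.subgroup_axioms, of y] by simp
      then show ?thesis unfolding A by (auto simp: r_coset_def)
    qed
    show "mdist ?Y (?q x) (?q y) \<le> mdist ?X x y" if "x \<in> mspace ?X" "y \<in> mspace ?X"
      using that q.mdist_image_le by simp
    show "\<exists>y\<in>mspace ?X. ?q y = t \<and> mdist ?X x y \<le> mdist ?Y (?q x) t"
      if "x \<in> mspace ?X" "t \<in> mspace ?Y"
      using that q.mdist_lift by simp
  qed (auto simp: G.mdist_word_left_mult carrier_FactGroup)
  interpret cone_fibration ?X ?A ?Y "(\<otimes>\<^bsub>G\<^esub>)" ?q "\<one>\<^bsub>G\<^esub>" "\<one>\<^bsub>G\<^esub>" "\<one>\<^bsub>G Mod N\<^esub>" \<omega> d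
    using assms(7,8) Q.one_closed by unfold_locales (auto simp: N.subset)
  interpret C: orbit_fibration X.Con A.Con Y.Con cone_act cone_p
    by (rule orbit_fibration_cones)
  have "mspace X.Con \<noteq> {}" using X.cls_in[OF X.base_seqs] by blast
  moreover have "geodesic_space X.Con"
    by (rule X.geodesic_space_Con) (use G.discrete_geodesic in simp)
  ultimately show ?thesis
    using C.bilipschitz_of_real_tree[OF assms(9) _ X.mcomplete_of_Con] by blast
qed

end
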